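(* A computable equivalence structure $\mathcal{A}$ is computably bi-embeddably categorical if and only if it has finitely many infinite equivalence classes and bounded character.
   Context: An equivalence structure $\mathcal{A}=(A,E)$ has universe $A\subseteq\omega$ and an equivalence relation $E$ on $A$; it is computable if its atomic diagram is computable. Two structures are bi-embeddable if each embeds into the other; a structure bi-embeddable with $\mathcal{A}$ is a bi-embeddable copy of $\mathcal{A}$. A computable structure $\mathcal{A}$ is computably bi-embeddably categorical if every computable bi-embeddable copy $\mathcal{B}$ of $\mathcal{A}$ is bi-embeddable with $\mathcal{A}$ via computable embeddings (a computable embedding $\mathcal{A}\hookrightarrow\mathcal{B}$ and a computable embedding $\mathcal{B}\hookrightarrow\mathcal{A}$). $\mathcal{A}$ has bounded character if there is a finite $k$ such that all finite equivalence classes of $\mathcal{A}$ have size at most $k$. *)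

theory Defs
  imports Main
begin

text \<open>recursive n f: f is a total recursive function of arity n, where arguments
are passed as a list of length n (Kleene's closure: zero, successor, projections,
composition, primitive recursion, regular minimisation).\<close>

inductive recursive :: "nat \<Rightarrow> (nat list \<Rightarrow> nat) \<Rightarrow> bool" where
  zero: "recursive n (\<lambda>_. 0)"
| succ: "recursive 1 (\<lambda>xs. Suc (hd xs))"
| proj: "i < n \<Longrightarrow> recursive n (\<lambda>xs. xs ! i)"
| comp: "recursive m g \<Longrightarrow> length fs = m \<Longrightarrow> (\<forall>f\<in>set fs. recursive n f)
          \<Longrightarrow> recursive n (\<lambda>xs. g (map (\<lambda>f. f xs) fs))"
| prim: "recursive n g \<Longrightarrow> recursive (Suc (Suc n)) h
          \<Longrightarrow> recursive (Suc n)
               (\<lambda>xs. rec_nat g (\<lambda>y r ys. h (y # r ys # ys)) (hd xs) (tl xs))"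
| mini: "recursive (Suc n) g \<Longrightarrow> (\<forall>xs. length xs = n \<longrightarrow> (\<exists>y. g (y # xs) = 0))
          \<Longrightarrow> recursive n (\<lambda>xs. LEAST y. g (y # xs) = 0)"

definition computable_fun :: "(nat \<Rightarrow> nat) \<Rightarrow> bool" where
  "computable_fun f \<longleftrightarrow> (\<exists>g. recursive 1 g \<and> (\<forall>x. f x = g [x]))"

definition computable_set :: "nat set \<Rightarrow> bool" where
  "computable_set A \<longleftrightarrow>
     (\<exists>g. recursive 1 g \<and> (\<forall>x. (x \<in> A \<longleftrightarrow> g [x] = 1) \<and> (x \<notin> A \<longleftrightarrow> g [x] = 0)))"

definition computable_rel :: "(nat \<times> nat) set \<Rightarrow> bool" where
  "computable_rel R \<longleftrightarrow>
     (\<exists>g. recursive 2 g \<and> (\<forall>x y. ((x, y) \<in> R \<longleftrightarrow> g [x, y] = 1) \<and> ((x, y) \<notin> R \<longleftrightarrow> g [x, y] = 0)))"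

definition eq_structure :: "nat set \<Rightarrow> (nat \<times> nat) set \<Rightarrow> bool" where
  "eq_structure A E \<longleftrightarrow> equiv A E"

text \<open>Computable: the atomic diagram (universe, E, and equality) is computable;
equality on nat is always decidable, so this amounts to A and E being computable.\<close>

definition computable_eq_structure :: "nat set \<Rightarrow> (nat \<times> nat) set \<Rightarrow> bool" where
  "computable_eq_structure A E \<longleftrightarrow> eq_structure A E \<and> computable_set A \<and> computable_rel E"

definition is_embedding ::
  "(nat \<Rightarrow> nat) \<Rightarrow> nat set \<Rightarrow> (nat \<times> nat) set \<Rightarrow> nat set \<Rightarrow> (nat \<times> nat) set \<Rightarrow> bool" where
  "is_embedding f A E B F \<longleftrightarrow> f ` A \<subseteq> B \<and> inj_on f A \<and>
     (\<forall>x\<in>A. \<forall>y\<in>A. (x, y) \<in> E \<longleftrightarrow> (f x, f y) \<in> F)"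

definition embeds :: "nat set \<Rightarrow> (nat \<times> nat) set \<Rightarrow> nat set \<Rightarrow> (nat \<times> nat) set \<Rightarrow> bool" where
  "embeds A E B F \<longleftrightarrow> (\<exists>f. is_embedding f A E B F)"

definition computably_embeds :: "nat set \<Rightarrow> (nat \<times> nat) set \<Rightarrow> nat set \<Rightarrow> (nat \<times> nat) set \<Rightarrow> bool" where
  "computably_embeds A E B F \<longleftrightarrow> (\<exists>f. computable_fun f \<and> is_embedding f A E B F)"

definition bi_embeddable :: "nat set \<Rightarrow> (nat \<times> nat) set \<Rightarrow> nat set \<Rightarrow> (nat \<times> nat) set \<Rightarrow> bool" where
  "bi_embeddable A E B F \<longleftrightarrow> embeds A E B F \<and> embeds B F A E"

definition computably_bi_embeddable :: "nat set \<Rightarrow> (nat \<times> nat) set \<Rightarrow> nat set \<Rightarrow> (nat \<times> nat) set \<Rightarrow> bool" where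
  "computably_bi_embeddable A E B F \<longleftrightarrow> computably_embeds A E B F \<and> computably_embeds B F A E"

definition comp_bi_emb_categorical :: "nat set \<Rightarrow> (nat \<times> nat) set \<Rightarrow> bool" where
  "comp_bi_emb_categorical A E \<longleftrightarrow>
     (\<forall>B F. computable_eq_structure B F \<and> bi_embeddable A E B F \<longrightarrow> computably_bi_embeddable A E B F)"

definition bounded_character :: "nat set \<Rightarrow> (nat \<times> nat) set \<Rightarrow> bool" where
  "bounded_character A E \<longleftrightarrow> (\<exists>k::nat. \<forall>C \<in> A // E. finite C \<longrightarrow> card C \<le> k)"

definition finitely_many_infinite_classes :: "nat set \<Rightarrow> (nat \<times> nat) set \<Rightarrow> bool" where
  "finitely_many_infinite_classes A E \<longleftrightarrow> finite {C \<in> A // E. infinite C}"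

end

theory Submission
  imports Defs "HOL-Library.Nat_Bijection" "HOL-Library.Infinite_Set"
begin

text \<open>If \<open>A\<close> has finitely many infinite classes and bounded character, then for some \<open>l\<close> all but finitely
  many classes are finite of size at most \<open>l\<close>, and (unless \<open>l = 0\<close>) infinitely many have size exactly
  \<open>l\<close>. An embedding into \<open>B\<close> is made computable by copying it on representatives of the finitely many
  exceptional classes and by sending the other classes to further classes of \<open>B\<close> with at least \<open>l\<close>
  elements, found by search; inside a class, the element of rank \<open>r\<close> goes to the element of rank \<open>r\<close>.
  These hypotheses pass to every bi-embeddable copy because infinite classes can be counted.

  Conversely, if \<open>A\<close> has infinitely many infinite classes, it is bi-embeddable with the structure with
  only infinite columns, and also with one whose infinite columns are indexed by the complement of a
  simple set; a computable embedding of the former into the latter would enumerate an infinite subset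
  of that complement. If \<open>A\<close> has \<open>m\<close> infinite classes and unbounded character, it is bi-embeddable with
  any structure with these two properties, but a computable embedding into the one with column sizes
  \<open>c + 1\<close> computes a bound for the sizes of finite classes, which a diagonal structure precludes.\<close>

section \<open>Closure properties of the computable functions\<close>

text \<open>Agreement is required only on lists of length \<open>n\<close>, so that expressions such
  as \<open>hd xs\<close> and \<open>xs ! 0\<close> become interchangeable; \<open>recursive\<close>
  itself speaks of functions on all lists.\<close>

definition computable_list_fun :: "nat \<Rightarrow> (nat list \<Rightarrow> nat) \<Rightarrow> bool" where
  "computable_list_fun n f \<longleftrightarrow> (\<exists>g. recursive n g \<and> (\<forall>xs. length xs = n \<longrightarrow> f xs = g xs))"

lemma computable_list_fun_cong:
  assumes "computable_list_fun n g" "\<And>xs. length xs = n \<Longrightarrow> f xs = g xs"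
  shows "computable_list_fun n f"
  using assms unfolding computable_list_fun_def by metis

lemma computable_fun_iff: "computable_fun f \<longleftrightarrow> computable_list_fun 1 (\<lambda>xs. f (hd xs))"
  unfolding computable_fun_def computable_list_fun_def
  by (metis (no_types, lifting) One_nat_def length_0_conv length_Cons length_Suc_conv list.sel(1))

lemma computable_list_fun_proj: "i < n \<Longrightarrow> computable_list_fun n (\<lambda>xs. xs ! i)"
  unfolding computable_list_fun_def using recursive.proj by blast

lemma computable_list_fun_hd: "0 < n \<Longrightarrow> computable_list_fun n hd"
  by (rule computable_list_fun_cong[OF computable_list_fun_proj[of 0]]) (auto simp: hd_conv_nth)

lemma computable_list_fun_comp:
  assumes "computable_list_fun m g" "length fs = m" "\<And>f. f \<in> set fs \<Longrightarrow> computable_list_fun n f"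
  shows "computable_list_fun n (\<lambda>xs. g (map (\<lambda>f. f xs) fs))"
proof -
  have "\<exists>hs. length hs = length fs \<and> (\<forall>h\<in>set hs. recursive n h) \<and>
      (\<forall>xs. length xs = n \<longrightarrow> map (\<lambda>f. f xs) fs = map (\<lambda>h. h xs) hs)"
    using assms(3)
  proof (induction fs)
    case (Cons f fs)
    obtain h where h: "recursive n h" "\<And>xs. length xs = n \<Longrightarrow> f xs = h xs"
      using Cons.prems[of f] unfolding computable_list_fun_def by auto
    obtain hs where "length hs = length fs" "\<forall>h\<in>set hs. recursive n h"
      "\<forall>xs. length xs = n \<longrightarrow> map (\<lambda>f. f xs) fs = map (\<lambda>h. h xs) hs"
      using Cons.IH Cons.prems by auto
    with h show ?case by (intro exI[of _ "h # hs"]) auto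
  qed simp
  then obtain hs where hs: "length hs = m" "\<forall>h\<in>set hs. recursive n h"
    "\<And>xs. length xs = n \<Longrightarrow> map (\<lambda>f. f xs) fs = map (\<lambda>h. h xs) hs"
    using assms(2) by auto
  obtain g' where g': "recursive m g'" "\<And>xs. length xs = m \<Longrightarrow> g xs = g' xs"
    using assms(1) unfolding computable_list_fun_def by auto
  show ?thesis
    unfolding computable_list_fun_def
    by (rule exI[of _ "\<lambda>xs. g' (map (\<lambda>h. h xs) hs)"]) (use hs g' in \<open>auto intro: recursive.comp\<close>)
qed

lemma computable_list_fun_comp1:
  assumes "computable_list_fun 1 (\<lambda>xs. f (hd xs))" "computable_list_fun n g"
  shows "computable_list_fun n (\<lambda>xs. f (g xs))"
  using computable_list_fun_comp[OF assms(1), of "[g]" n] assms(2) by simp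

lemma computable_list_fun_comp2:
  assumes "computable_list_fun 2 (\<lambda>xs. f (xs ! 0) (xs ! 1))"
    "computable_list_fun n g" "computable_list_fun n h"
  shows "computable_list_fun n (\<lambda>xs. f (g xs) (h xs))"
  using computable_list_fun_comp[OF assms(1), of "[g, h]" n] assms(2,3) by auto

lemma computable_list_fun_const: "computable_list_fun n (\<lambda>xs. c)"
proof (induction c)
  case 0
  show ?case unfolding computable_list_fun_def using recursive.zero by blast
next
  case (Suc c)
  have "computable_list_fun 1 (\<lambda>xs. Suc (hd xs))"
    unfolding computable_list_fun_def using recursive.succ by blast
  from computable_list_fun_comp1[OF this Suc] show ?case .
qed

lemma computable_list_fun_Suc:
  "computable_list_fun n f \<Longrightarrow> computable_list_fun n (\<lambda>xs. Suc (f xs))"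
  by (rule computable_list_fun_comp1[of Suc])
    (use recursive.succ in \<open>auto simp: computable_list_fun_def\<close>)

lemma computable_list_fun_rec_nat:
  assumes "computable_list_fun n g" "computable_list_fun (Suc (Suc n)) h"
  shows "computable_list_fun (Suc n)
    (\<lambda>xs. rec_nat (g (tl xs)) (\<lambda>y r. h (y # r # tl xs)) (hd xs))"
proof -
  obtain g' h' where gh: "recursive n g'" "\<And>xs. length xs = n \<Longrightarrow> g xs = g' xs"
    "recursive (Suc (Suc n)) h'" "\<And>xs. length xs = Suc (Suc n) \<Longrightarrow> h xs = h' xs"
    using assms unfolding computable_list_fun_def by auto
  have "rec_nat (g ys) (\<lambda>y r. h (y # r # ys)) k = rec_nat g' (\<lambda>y r ys. h' (y # r ys # ys)) k ys"
    if "length ys = n" for ys k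
    by (induction k) (use gh that in auto)
  then show ?thesis
    unfolding computable_list_fun_def using recursive.prim[OF gh(1,3)]
    by (intro exI[of _ "\<lambda>xs. rec_nat g' (\<lambda>y r ys. h' (y # r ys # ys)) (hd xs) (tl xs)"]) simp
qed

lemma computable_list_fun_Least:
  assumes "computable_list_fun (Suc n) g" "\<And>xs. length xs = n \<Longrightarrow> \<exists>y. g (y # xs) = 0"
  shows "computable_list_fun n (\<lambda>xs. LEAST y. g (y # xs) = 0)"
proof -
  obtain g' where g': "recursive (Suc n) g'" "\<And>xs. length xs = Suc n \<Longrightarrow> g xs = g' xs"
    using assms(1) unfolding computable_list_fun_def by auto
  then have "recursive n (\<lambda>xs. LEAST y. g' (y # xs) = 0)"
    using assms(2) by (intro recursive.mini) auto
  with g'(2) show ?thesis unfolding computable_list_fun_def by (auto intro!: exI)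
qed

lemma computable_list_fun_add:
  assumes "computable_list_fun n f" "computable_list_fun n g"
  shows "computable_list_fun n (\<lambda>xs. f xs + g xs)"
proof (rule computable_list_fun_comp2[OF _ assms])
  have "computable_list_fun 2
      (\<lambda>xs. rec_nat (hd (tl xs)) (\<lambda>y r. Suc ((y # r # tl xs) ! 1)) (hd xs))"
    using computable_list_fun_rec_nat[of 1 hd "\<lambda>xs. Suc (xs ! 1)"]
    by (simp add: computable_list_fun_hd computable_list_fun_proj computable_list_fun_Suc
        numeral_2_eq_2)
  moreover have "rec_nat a (\<lambda>y. Suc) b = b + a" for a b by (induction b) auto
  ultimately show "computable_list_fun 2 (\<lambda>xs. xs ! 0 + xs ! 1)"
    by (elim computable_list_fun_cong) (auto simp: numeral_2_eq_2 length_Suc_conv)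
qed

lemma computable_list_fun_diff:
  assumes "computable_list_fun n f" "computable_list_fun n g"
  shows "computable_list_fun n (\<lambda>xs. f xs - g xs)"
proof (rule computable_list_fun_comp2[OF _ assms])
  have "computable_list_fun 1 (\<lambda>xs. rec_nat 0 (\<lambda>y r. (y # r # tl xs) ! 0) (hd xs))"
    using computable_list_fun_rec_nat[of 0 "\<lambda>_. 0" "\<lambda>xs. xs ! 0"]
    by (simp add: computable_list_fun_const computable_list_fun_proj)
  moreover have "rec_nat 0 (\<lambda>y r. y) b = b - 1" for b by (induction b) auto
  ultimately have pred: "computable_list_fun 1 (\<lambda>xs. hd xs - 1)"
    by (elim computable_list_fun_cong) auto
  have "computable_list_fun (Suc (Suc 1)) (\<lambda>xs. xs ! 1 - 1)"
    by (rule computable_list_fun_comp1[OF pred]) (simp add: computable_list_fun_proj)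
  then have "computable_list_fun 2
      (\<lambda>xs. rec_nat (hd (tl xs)) (\<lambda>y r. (y # r # tl xs) ! 1 - 1) (hd xs))"
    using computable_list_fun_rec_nat[of 1 hd "\<lambda>xs. xs ! 1 - 1"]
    by (simp add: computable_list_fun_hd numeral_2_eq_2)
  moreover have "rec_nat a (\<lambda>y r. r - Suc 0) b = a - b" for a b by (induction b) auto
  ultimately have "computable_list_fun 2 (\<lambda>xs. xs ! 1 - xs ! 0)"
    by (elim computable_list_fun_cong) (auto simp: numeral_2_eq_2 length_Suc_conv)
  from computable_list_fun_comp2[OF this computable_list_fun_proj[of 1] computable_list_fun_proj[of 0]]
  show "computable_list_fun 2 (\<lambda>xs. xs ! 0 - xs ! 1)" by simp
qed

lemma computable_list_fun_triangle:
  assumes "computable_list_fun n f"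
  shows "computable_list_fun n (\<lambda>xs. triangle (f xs))"
proof (rule computable_list_fun_comp1[OF _ assms])
  have "computable_list_fun (Suc (Suc 0)) (\<lambda>xs. xs ! 1 + Suc (xs ! 0))"
    by (intro computable_list_fun_add computable_list_fun_Suc computable_list_fun_proj) auto
  then have "computable_list_fun 1
      (\<lambda>xs. rec_nat 0 (\<lambda>y r. (y # r # tl xs) ! 1 + Suc ((y # r # tl xs) ! 0)) (hd xs))"
    using computable_list_fun_rec_nat[of 0 "\<lambda>_. 0" "\<lambda>xs. xs ! 1 + Suc (xs ! 0)"]
    by (simp add: computable_list_fun_const)
  moreover have "rec_nat 0 (\<lambda>y r. Suc (r + y)) b = triangle b" for b by (induction b) auto
  ultimately show "computable_list_fun 1 (\<lambda>xs. triangle (hd xs))"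
    by (elim computable_list_fun_cong) auto
qed

section \<open>Computability of the Cantor pairing and its inverse\<close>

abbreviation pair :: "nat \<Rightarrow> nat \<Rightarrow> nat" where
  "pair a b \<equiv> prod_encode (a, b)"

definition p1 :: "nat \<Rightarrow> nat" where "p1 x = fst (prod_decode x)"
definition p2 :: "nat \<Rightarrow> nat" where "p2 x = snd (prod_decode x)"

lemma p1_pair [simp]: "p1 (pair a b) = a"
  and p2_pair [simp]: "p2 (pair a b) = b"
  and pair_p1_p2 [simp]: "pair (p1 x) (p2 x) = x"
  by (simp_all add: p1_def p2_def)

lemma computable_list_fun_pair:
  assumes "computable_list_fun n f" "computable_list_fun n g"
  shows "computable_list_fun n (\<lambda>xs. pair (f xs) (g xs))"
  unfolding prod_encode_def
  using assms by (auto intro!: computable_list_fun_add computable_list_fun_triangle)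

text \<open>The code of \<open>(a, b)\<close> is \<open>triangle (a + b) + a\<close>, so
  \<open>a + b\<close> is the least \<open>w\<close> whose next triangular number exceeds the code.
  With truncated subtraction this is a search for a zero, and decoding becomes a
  minimisation.\<close>

lemma triangle_root: "(LEAST w. Suc x - triangle (Suc w) = 0) = p1 x + p2 x"
proof -
  have x: "x = triangle (p1 x + p2 x) + p1 x"
    using pair_p1_p2[of x] unfolding prod_encode_def by simp
  have mono: "triangle a \<le> triangle b" if "a \<le> b" for a b
    using that by (induction rule: dec_induct) auto
  show ?thesis
  proof (rule Least_equality)
    show "Suc x - triangle (Suc (p1 x + p2 x)) = 0" by (subst x) simp
  next
    fix w assume "Suc x - triangle (Suc w) = 0"
    then have "x < triangle (Suc w)" by simp
    then have "\<not> Suc w \<le> p1 x + p2 x" using mono[of "Suc w" "p1 x + p2 x"] x by linarith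
    then show "p1 x + p2 x \<le> w" by simp
  qed
qed

lemma computable_list_fun_p1_plus_p2: "computable_list_fun 1 (\<lambda>xs. p1 (hd xs) + p2 (hd xs))"
proof -
  have "computable_list_fun (Suc 1) (\<lambda>xs. Suc (xs ! 1) - triangle (Suc (xs ! 0)))"
    by (intro computable_list_fun_diff computable_list_fun_Suc computable_list_fun_triangle
        computable_list_fun_proj) auto
  moreover have "\<exists>w. Suc x - triangle (Suc w) = 0" for x
    by (rule exI[of _ x]) (simp add: triangle_def)
  ultimately have "computable_list_fun 1
      (\<lambda>xs. LEAST w. Suc ((w # xs) ! 1) - triangle (Suc ((w # xs) ! 0)) = 0)"
    by (intro computable_list_fun_Least) auto
  then show ?thesis
    by (rule computable_list_fun_cong) (auto simp flip: triangle_root simp: length_Suc_conv)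
qed

lemma computable_list_fun_p1:
  assumes "computable_list_fun n f"
  shows "computable_list_fun n (\<lambda>xs. p1 (f xs))"
proof (rule computable_list_fun_comp1[OF _ assms])
  have "computable_list_fun 1 (\<lambda>xs. hd xs - triangle (p1 (hd xs) + p2 (hd xs)))"
    by (intro computable_list_fun_diff computable_list_fun_triangle
        computable_list_fun_p1_plus_p2 computable_list_fun_hd) simp
  moreover have "x - triangle (p1 x + p2 x) = p1 x" for x
    using pair_p1_p2[of x] unfolding prod_encode_def by simp
  ultimately show "computable_list_fun 1 (\<lambda>xs. p1 (hd xs))" by simp
qed

lemma computable_list_fun_p2:
  assumes "computable_list_fun n f"
  shows "computable_list_fun n (\<lambda>xs. p2 (f xs))"
proof (rule computable_list_fun_comp1[OF _ assms])
  have "computable_list_fun 1 (\<lambda>xs. (p1 (hd xs) + p2 (hd xs)) - p1 (hd xs))"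
    by (intro computable_list_fun_diff computable_list_fun_p1_plus_p2 computable_list_fun_p1
        computable_list_fun_hd) auto
  then show "computable_list_fun 1 (\<lambda>xs. p2 (hd xs))" by simp
qed

lemma computable_fun_comp_list:
  "computable_fun f \<Longrightarrow> computable_list_fun n g \<Longrightarrow> computable_list_fun n (\<lambda>xs. f (g xs))"
  unfolding computable_fun_iff by (rule computable_list_fun_comp1)

lemma computable_fun_compose:
  "computable_fun f \<Longrightarrow> computable_fun g \<Longrightarrow> computable_fun (\<lambda>x. f (g x))"
  unfolding computable_fun_iff[of g] computable_fun_iff[of "\<lambda>x. f (g x)"]
  by (rule computable_fun_comp_list)

lemma computable_fun_id: "computable_fun (\<lambda>x. x)"
  unfolding computable_fun_iff by (simp add: computable_list_fun_hd)

lemma computable_fun_const: "computable_fun (\<lambda>x. c)"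
  unfolding computable_fun_iff by (rule computable_list_fun_const)

lemma computable_fun_Suc: "computable_fun f \<Longrightarrow> computable_fun (\<lambda>x. Suc (f x))"
  unfolding computable_fun_iff by (rule computable_list_fun_Suc)

lemma computable_fun_add:
  "computable_fun f \<Longrightarrow> computable_fun g \<Longrightarrow> computable_fun (\<lambda>x. f x + g x)"
  unfolding computable_fun_iff by (rule computable_list_fun_add)

lemma computable_fun_diff:
  "computable_fun f \<Longrightarrow> computable_fun g \<Longrightarrow> computable_fun (\<lambda>x. f x - g x)"
  unfolding computable_fun_iff by (rule computable_list_fun_diff)

lemma computable_fun_pair:
  "computable_fun f \<Longrightarrow> computable_fun g \<Longrightarrow> computable_fun (\<lambda>x. pair (f x) (g x))"
  unfolding computable_fun_iff by (rule computable_list_fun_pair)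

lemma computable_fun_p1: "computable_fun f \<Longrightarrow> computable_fun (\<lambda>x. p1 (f x))"
  unfolding computable_fun_iff by (rule computable_list_fun_p1)

lemma computable_fun_p2: "computable_fun f \<Longrightarrow> computable_fun (\<lambda>x. p2 (f x))"
  unfolding computable_fun_iff by (rule computable_list_fun_p2)

text \<open>Functions of several variables are treated as unary functions of nested pairs: below a binder
  the context variable becomes \<open>p1 q\<close> and the bound variable \<open>p2 q\<close>.\<close>

lemma computable_fun_rec_nat:
  assumes "computable_fun b" "computable_fun g"
    and h: "computable_fun (\<lambda>q. h (p1 (p1 q)) (p2 (p1 q)) (p2 q))"
  shows "computable_fun (\<lambda>x. rec_nat (g x) (\<lambda>y r. h x y r) (b x))"
proof -
  \<comment> \<open>In the list form of the step function the counter comes first, the previous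
    value second and the context third; the pairing puts the context innermost.\<close>
  have "computable_list_fun (Suc (Suc 1))
     (\<lambda>xs. (\<lambda>q. h (p1 (p1 q)) (p2 (p1 q)) (p2 q)) (pair (pair (xs ! 2) (xs ! 0)) (xs ! 1)))"
    by (intro computable_fun_comp_list[OF h] computable_list_fun_pair computable_list_fun_proj) auto
  moreover have "computable_list_fun 1 (\<lambda>xs. g (hd xs))"
    using assms(2) by (simp add: computable_fun_iff)
  ultimately have "computable_list_fun (Suc 1) (\<lambda>xs. rec_nat (g (hd (tl xs)))
     (\<lambda>y r. h ((y # r # tl xs) ! 2) ((y # r # tl xs) ! 0) ((y # r # tl xs) ! 1)) (hd xs))"
    using computable_list_fun_rec_nat[of 1 "\<lambda>xs. g (hd xs)"
      "\<lambda>xs. h (xs ! 2) (xs ! 0) (xs ! 1)"] by simp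
  then have "computable_list_fun 2
      (\<lambda>xs. rec_nat (g (xs ! 1)) (\<lambda>y r. h (xs ! 1) y r) (xs ! 0))"
    unfolding numeral_2_eq_2 One_nat_def
    by (elim computable_list_fun_cong) (auto simp: numeral_2_eq_2 length_Suc_conv)
  from computable_list_fun_comp2[OF this, of 1 "\<lambda>xs. b (hd xs)" hd] show ?thesis
    using assms(1) by (simp add: computable_fun_iff computable_list_fun_hd)
qed

section \<open>Decidable predicates and search\<close>

definition decidable :: "(nat \<Rightarrow> bool) \<Rightarrow> bool" where
  "decidable P \<longleftrightarrow> computable_fun (\<lambda>x. if P x then 1 else 0)"

lemma computable_fun_Least:
  assumes P: "decidable (\<lambda>q. P (p1 q) (p2 q))" and "\<And>x. \<exists>z. P x z"
  shows "computable_fun (\<lambda>x. LEAST z. P x z)"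
proof -
  \<comment> \<open>Minimisation looks for a zero, so the characteristic function is subtracted from
    1.\<close>
  have "computable_list_fun (Suc 1)
     (\<lambda>xs. 1 - (\<lambda>q. if P (p1 q) (p2 q) then 1 else 0) (pair (xs ! 1) (xs ! 0)))"
    by (intro computable_list_fun_diff computable_list_fun_const computable_list_fun_pair
        computable_fun_comp_list[OF P[unfolded decidable_def]] computable_list_fun_proj) auto
  then have "computable_list_fun 1
      (\<lambda>xs. LEAST z. 1 - (if P ((z # xs) ! 1) ((z # xs) ! 0) then 1 else (0::nat)) = 0)"
    using computable_list_fun_Least[of 1
      "\<lambda>xs. 1 - (if P (xs ! 1) (xs ! 0) then 1 else (0::nat))"] assms(2)
    by (auto split: if_splits)
  then show ?thesis unfolding computable_fun_iff
  proof (rule computable_list_fun_cong)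
    fix xs :: "nat list" assume "length xs = 1"
    then show "(LEAST z. P (hd xs) z) =
        (LEAST z. 1 - (if P ((z # xs) ! 1) ((z # xs) ! 0) then 1 else (0::nat)) = 0)"
      by (intro arg_cong[of _ _ Least]) (auto simp: length_Suc_conv)
  qed
qed

text \<open>Case distinction is a primitive recursion whose length is the truth value 0 or
  1.\<close>

lemma computable_fun_if:
  assumes "decidable P" "computable_fun f" "computable_fun g"
  shows "computable_fun (\<lambda>x. if P x then f x else g x)"
proof -
  have "computable_fun (\<lambda>x. rec_nat (g x) (\<lambda>_ _. f x) (if P x then 1 else 0))"
    by (rule computable_fun_rec_nat[OF assms(1)[unfolded decidable_def] assms(3)])
      (intro computable_fun_compose[OF assms(2)] computable_fun_p1 computable_fun_id)
  then show ?thesis by (rule back_subst[of computable_fun]) auto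
qed

lemma decidable_eq_0: "computable_fun f \<Longrightarrow> decidable (\<lambda>x. f x = 0)"
proof -
  assume f: "computable_fun f"
  have "computable_fun (\<lambda>x. 1 - f x)" by (intro computable_fun_diff computable_fun_const f)
  then show ?thesis unfolding decidable_def by (rule back_subst[of computable_fun]) auto
qed

lemma decidable_compose: "decidable P \<Longrightarrow> computable_fun f \<Longrightarrow> decidable (\<lambda>x. P (f x))"
  unfolding decidable_def by (rule computable_fun_compose)

lemma decidable_not:
  assumes "decidable P" shows "decidable (\<lambda>x. \<not> P x)"
proof -
  have "computable_fun (\<lambda>x. if P x then 0 else 1)"
    by (intro computable_fun_if assms computable_fun_const)
  then show ?thesis unfolding decidable_def by (rule back_subst[of computable_fun]) auto
qed

lemma decidable_conj:
  assumes "decidable P" "decidable Q" shows "decidable (\<lambda>x. P x \<and> Q x)"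
  using computable_fun_if[OF assms(1) assms(2)[unfolded decidable_def] computable_fun_const[of 0]]
  unfolding decidable_def by (rule back_subst[of computable_fun]) auto

lemma decidable_disj:
  assumes "decidable P" "decidable Q" shows "decidable (\<lambda>x. P x \<or> Q x)"
  using decidable_not[OF decidable_conj[OF assms[THEN decidable_not]]] by simp

lemma decidable_imp:
  assumes "decidable P" "decidable Q" shows "decidable (\<lambda>x. P x \<longrightarrow> Q x)"
  using decidable_disj[OF decidable_not[OF assms(1)] assms(2)] by simp

lemma decidable_le:
  assumes "computable_fun f" "computable_fun g" shows "decidable (\<lambda>x. f x \<le> g x)"
  using decidable_eq_0[OF computable_fun_diff[OF assms]] by simp

lemma decidable_less:
  assumes "computable_fun f" "computable_fun g" shows "decidable (\<lambda>x. f x < g x)"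
  using decidable_not[OF decidable_le[OF assms(2,1)]] by (simp add: not_le)

lemma decidable_eq:
  assumes "computable_fun f" "computable_fun g" shows "decidable (\<lambda>x. f x = g x)"
  using decidable_conj[OF decidable_le[OF assms] decidable_le[OF assms(2,1)]]
  unfolding order_eq_iff[symmetric] .

text \<open>Minimisation has to be total, so the search is also allowed to stop at the bound; a
  witness exists iff it stops earlier.\<close>

lemma decidable_ex_less:
  assumes P: "decidable (\<lambda>q. P (p1 q) (p2 q))" and b: "computable_fun b"
  shows "decidable (\<lambda>x. \<exists>z<b x. P x z)"
proof -
  have "computable_fun (\<lambda>x. LEAST z. b x \<le> z \<or> P x z)"
    by (rule computable_fun_Least, intro decidable_disj P decidable_le computable_fun_compose[OF b]
        computable_fun_p1 computable_fun_p2 computable_fun_id) auto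
  then have "decidable (\<lambda>x. (LEAST z. b x \<le> z \<or> P x z) < b x)"
    by (rule decidable_less[OF _ b])
  moreover have "(LEAST z. b x \<le> z \<or> P x z) < b x \<longleftrightarrow> (\<exists>z<b x. P x z)" for x
  proof
    assume "(LEAST z. b x \<le> z \<or> P x z) < b x"
    moreover have "b x \<le> (LEAST z. b x \<le> z \<or> P x z) \<or> P x (LEAST z. b x \<le> z \<or> P x z)"
      by (rule LeastI[of _ "b x"]) simp
    ultimately show "\<exists>z<b x. P x z" by auto
  next
    assume "\<exists>z<b x. P x z"
    then obtain z where "z < b x" "P x z" by auto
    then show "(LEAST z. b x \<le> z \<or> P x z) < b x"
      using Least_le[of "\<lambda>z. b x \<le> z \<or> P x z" z] by simp
  qed
  ultimately show ?thesis by simp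
qed

lemma decidable_all_less:
  assumes "decidable (\<lambda>q. P (p1 q) (p2 q))" "computable_fun b"
  shows "decidable (\<lambda>x. \<forall>z<b x. P x z)"
  using decidable_not[OF decidable_ex_less[OF assms(1)[THEN decidable_not] assms(2)]] by simp

lemma decidable_mem: "computable_set A \<Longrightarrow> computable_fun f \<Longrightarrow> decidable (\<lambda>x. f x \<in> A)"
proof (rule decidable_compose[of "\<lambda>x. x \<in> A"])
  assume "computable_set A"
  then obtain g where "recursive 1 g" "\<And>x. x \<in> A \<longleftrightarrow> g [x] = 1" "\<And>x. x \<notin> A \<longleftrightarrow> g [x] = 0"
    unfolding computable_set_def by auto
  then show "decidable (\<lambda>x. x \<in> A)"
    unfolding decidable_def computable_fun_def by (intro exI[of _ g]) auto
qed

lemma decidable_rel: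
  assumes "computable_rel R" "computable_fun f" "computable_fun g"
  shows "decidable (\<lambda>x. (f x, g x) \<in> R)"
proof -
  obtain h where h: "recursive 2 h" "\<And>x y. (x, y) \<in> R \<longleftrightarrow> h [x, y] = 1"
    "\<And>x y. (x, y) \<notin> R \<longleftrightarrow> h [x, y] = 0"
    using assms(1) unfolding computable_rel_def by blast
  have "computable_list_fun 2 (\<lambda>xs. if (xs ! 0, xs ! 1) \<in> R then 1 else 0)"
    unfolding computable_list_fun_def using h
    by (intro exI[of _ h]) (auto simp: numeral_2_eq_2 length_Suc_conv)
  from computable_list_fun_comp2[of "\<lambda>x y. if (x, y) \<in> R then 1 else 0",
      OF this assms(2,3)[unfolded computable_fun_iff]]
  show ?thesis unfolding decidable_def computable_fun_iff .
qed

lemmas computable_intros =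
  computable_fun_id computable_fun_const computable_fun_Suc computable_fun_add computable_fun_diff
  computable_fun_pair computable_fun_p1 computable_fun_p2 computable_fun_if
  decidable_not decidable_conj decidable_disj decidable_imp decidable_le decidable_less decidable_eq
  decidable_ex_less decidable_all_less

lemma computable_setI: "decidable (\<lambda>x. x \<in> A) \<Longrightarrow> computable_set A"
  unfolding computable_set_def decidable_def computable_fun_def
  by (elim exE conjE, rule_tac x=g in exI) (metis zero_neq_one)

lemma computable_relI:
  assumes "decidable (\<lambda>q. (p1 q, p2 q) \<in> R)"
  shows "computable_rel R"
proof -
  have "computable_list_fun 2
      (\<lambda>xs. (\<lambda>q. if (p1 q, p2 q) \<in> R then 1 else 0) (pair (xs ! 0) (xs ! 1)))"
    by (intro computable_fun_comp_list[OF assms[unfolded decidable_def]] computable_list_fun_pair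
        computable_list_fun_proj) auto
  then obtain g where g: "recursive 2 g"
    "\<And>xs. length xs = 2 \<Longrightarrow> (if (xs ! 0, xs ! 1) \<in> R then 1 else 0) = g xs"
    unfolding computable_list_fun_def by auto
  have "g [x, y] = (if (x, y) \<in> R then 1 else 0)" for x y
    using g(2)[of "[x, y]"] by simp
  with g(1) show ?thesis unfolding computable_rel_def by (intro exI[of _ g]) auto
qed

lemma computable_fun_card_less:
  assumes P: "decidable (\<lambda>q. P (p1 q) (p2 q))" and b: "computable_fun b"
  shows "computable_fun (\<lambda>x. card {z. z < b x \<and> P x z})"
proof -
  have "decidable (\<lambda>q. P (p1 (p1 q)) (p2 (p1 q)))"
    using decidable_compose[OF P computable_fun_p1[OF computable_fun_id]] by simp
  then have "computable_fun (\<lambda>x. rec_nat 0 (\<lambda>z r. if P x z then Suc r else r) (b x))"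
    by (intro computable_fun_rec_nat b computable_intros)
  moreover have "rec_nat 0 (\<lambda>z r. if P x z then Suc r else r) k = card {z. z < k \<and> P x z}" for x k
  proof (induction k)
    case (Suc k)
    have "{z. z < Suc k \<and> P x z} = (if P x k then insert k else id) {z. z < k \<and> P x z}"
      by (auto simp: less_Suc_eq)
    then show ?case using Suc by auto
  qed simp
  ultimately show ?thesis by simp
qed

text \<open>Membership is a binary digit of the code, that is, the parity after repeated halving.
  Halving comes from minimisation, its iteration from primitive recursion.\<close>

lemma decidable_set_decode:
  assumes "computable_fun f" "computable_fun g"
  shows "decidable (\<lambda>x. f x \<in> set_decode (g x))"
proof -
  have half: "computable_fun (\<lambda>x. LEAST z. x \<le> Suc (z + z))"
    by (rule computable_fun_Least, intro computable_intros) (meson le_SucI le_add1)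
  have "(LEAST z. x \<le> Suc (z + z)) = x div 2" for x :: nat
    by (rule Least_equality) presburger+
  with half have half: "computable_fun (\<lambda>x. x div 2)" by simp
  have "computable_fun (\<lambda>x. rec_nat (g x) (\<lambda>_ r. r div 2) (f x))"
    by (intro computable_fun_rec_nat assms computable_fun_compose[OF half] computable_intros)
  moreover have "rec_nat a (\<lambda>_ r. r div 2) k = a div 2 ^ k" for a k :: nat
    by (induction k) (auto simp: div_mult2_eq power_Suc2 simp del: power_Suc)
  ultimately have q: "computable_fun (\<lambda>x. g x div 2 ^ f x)" by simp
  have "decidable (\<lambda>x. g x div 2 ^ f x \<noteq> (g x div 2 ^ f x) div 2 + (g x div 2 ^ f x) div 2)"
    by (intro computable_intros computable_fun_compose[OF half] q)
  moreover have "n \<noteq> n div 2 + n div 2 \<longleftrightarrow> odd n" for n :: nat by presburger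
  ultimately show ?thesis by (simp add: set_decode_def)
qed

section \<open>A decidable halting predicate\<close>

text \<open>A program is a code \<open>pair tag (pair a b)\<close> for a unary function on encoded argument lists. A triple
  \<open>\<langle>e, x, y\<rangle>\<close> asserts that program \<open>e\<close> yields \<open>y\<close> on \<open>x\<close>, and \<open>justified D e x y\<close> says that this is
  an instance of an evaluation rule (0: zero, 1: successor, 2, 3: projections, 4: pairing,
  5: composition, 6: primitive recursion, 7: minimisation) with premises in \<open>D\<close>. Every rule except
  6 refers to smaller programs and 6 to a smaller argument, so a finite set all of whose triples are
  justified is a computation, and its order need not be recorded.\<close>

definition triple :: "nat \<Rightarrow> nat \<Rightarrow> nat \<Rightarrow> nat" where
  "triple e x y = pair e (pair x y)"

definition code :: "nat \<Rightarrow> nat \<Rightarrow> nat \<Rightarrow> nat" where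
  "code t a b = pair t (pair a b)"

definition justified :: "nat set \<Rightarrow> nat \<Rightarrow> nat \<Rightarrow> nat \<Rightarrow> bool" where
  "justified D e x y \<longleftrightarrow> (let t = p1 e; a = p1 (p2 e); b = p2 (p2 e) in
     (t = 0 \<and> y = 0) \<or> (t = 1 \<and> y = Suc x) \<or> (t = 2 \<and> y = p1 x) \<or> (t = 3 \<and> y = p2 x) \<or>
     (t = 4 \<and> triple a x (p1 y) \<in> D \<and> triple b x (p2 y) \<in> D) \<or>
     (t = 5 \<and> (\<exists>z. triple b x z \<in> D \<and> triple a z y \<in> D)) \<or>
     (t = 6 \<and> p1 x = 0 \<and> triple a (p2 x) y \<in> D) \<or>
     (t = 6 \<and> p1 x \<noteq> 0 \<and> (\<exists>r. triple e (pair (p1 x - 1) (p2 x)) r \<in> D \<and>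
        triple b (pair (p1 x - 1) (pair r (p2 x))) y \<in> D)) \<or>
     (t = 7 \<and> triple a (pair y x) 0 \<in> D \<and> (\<forall>z<y. \<exists>r. triple a (pair z x) (Suc r) \<in> D)))"

lemma justified_simps:
  "justified D (code 0 a b) x y \<longleftrightarrow> y = 0"
  "justified D (code 1 a b) x y \<longleftrightarrow> y = Suc x"
  "justified D (code 2 a b) x y \<longleftrightarrow> y = p1 x"
  "justified D (code 3 a b) x y \<longleftrightarrow> y = p2 x"
  "justified D (code 4 a b) x y \<longleftrightarrow> triple a x (p1 y) \<in> D \<and> triple b x (p2 y) \<in> D"
  "justified D (code 5 a b) x y \<longleftrightarrow> (\<exists>z. triple b x z \<in> D \<and> triple a z y \<in> D)"
  "justified D (code 6 a b) (pair 0 x) y \<longleftrightarrow> triple a x y \<in> D"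
  "justified D (code 6 a b) (pair (Suc n) x) y \<longleftrightarrow>
     (\<exists>r. triple (code 6 a b) (pair n x) r \<in> D \<and> triple b (pair n (pair r x)) y \<in> D)"
  "justified D (code 7 a b) x y \<longleftrightarrow>
     triple a (pair y x) 0 \<in> D \<and> (\<forall>z<y. \<exists>r. triple a (pair z x) (Suc r) \<in> D)"
  by (simp_all add: justified_def code_def)

text \<open>\<open>D\<close> occurs only positively in the rules. This is what allows computations
  to be united.\<close>

lemma justified_mono: "justified D e x y \<Longrightarrow> D \<subseteq> D' \<Longrightarrow> justified D' e x y"
  unfolding justified_def Let_def by (elim disjE) (simp_all, blast+)

definition computation :: "nat set \<Rightarrow> bool" where
  "computation D \<longleftrightarrow> finite D \<and> (\<forall>t\<in>D. justified D (p1 t) (p1 (p2 t)) (p2 (p2 t)))"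

lemma computationD: "computation D \<Longrightarrow> triple e x y \<in> D \<Longrightarrow> justified D e x y"
  unfolding computation_def triple_def by fastforce

lemma computation_Un: "computation D \<Longrightarrow> computation D' \<Longrightarrow> computation (D \<union> D')"
  unfolding computation_def by (auto intro: justified_mono)

lemma computation_insert:
  assumes "computation D" "justified D e x y"
  shows "computation (insert (triple e x y) D)"
  using assms unfolding computation_def by (auto simp: triple_def intro: justified_mono)

text \<open>Uniqueness of the value is part of the notion, so that existence and uniqueness are
  carried through one and the same induction.\<close>

definition evaluates :: "nat \<Rightarrow> nat \<Rightarrow> nat \<Rightarrow> bool" where
  "evaluates e x y \<longleftrightarrow> (\<exists>D. computation D \<and> triple e x y \<in> D) \<and>
     (\<forall>D z. computation D \<longrightarrow> triple e x z \<in> D \<longrightarrow> z = y)"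

text \<open>Every triple of a computation is justified inside it, so uniqueness has to be checked
  only for the last rule applied.\<close>

lemma evaluatesI:
  assumes "computation D" "justified D e x y"
    "\<And>D z. computation D \<Longrightarrow> justified D e x z \<Longrightarrow> z = y"
  shows "evaluates e x y"
  unfolding evaluates_def using computation_insert[OF assms(1,2)] assms(3) computationD by blast

lemma evaluatesE:
  assumes "evaluates e x y"
  obtains D where "computation D" "triple e x y \<in> D"
  using assms unfolding evaluates_def by blast

lemma evaluates_unique:
  "evaluates e x y \<Longrightarrow> computation D \<Longrightarrow> triple e x z \<in> D \<Longrightarrow> z = y"
  unfolding evaluates_def by blast

lemma computation_empty: "computation {}"
  by (simp add: computation_def)

lemma evaluates_zero: "evaluates (code 0 a b) x 0"
  and evaluates_Suc: "evaluates (code 1 a b) x (Suc x)"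
  and evaluates_p1: "evaluates (code 2 a b) x (p1 x)"
  and evaluates_p2: "evaluates (code 3 a b) x (p2 x)"
  by (rule evaluatesI[OF computation_empty]; simp only: justified_simps)+

lemma evaluates_pair:
  assumes "evaluates a x u" "evaluates b x v"
  shows "evaluates (code 4 a b) x (pair u v)"
proof -
  obtain D D' where D: "computation D" "triple a x u \<in> D" "computation D'" "triple b x v \<in> D'"
    using assms by (meson evaluatesE)
  show ?thesis
  proof (rule evaluatesI[OF computation_Un[OF D(1,3)]])
    show "justified (D \<union> D') (code 4 a b) x (pair u v)" using D by (simp add: justified_simps)
  next
    fix D z assume "computation D" "justified D (code 4 a b) x z"
    then have "p1 z = u" "p2 z = v" using assms evaluates_unique by (auto simp: justified_simps)
    then show "z = pair u v" by (metis pair_p1_p2)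
  qed
qed

lemma evaluates_comp:
  assumes "evaluates b x u" "evaluates a u v"
  shows "evaluates (code 5 a b) x v"
proof -
  obtain D D' where D: "computation D" "triple b x u \<in> D" "computation D'" "triple a u v \<in> D'"
    using assms by (meson evaluatesE)
  show ?thesis
  proof (rule evaluatesI[OF computation_Un[OF D(1,3)]])
    show "justified (D \<union> D') (code 5 a b) x v" using D by (auto simp: justified_simps)
  next
    fix D z assume D: "computation D" "justified D (code 5 a b) x z"
    then obtain w where w: "triple b x w \<in> D" "triple a w z \<in> D" by (auto simp: justified_simps)
    with evaluates_unique[OF assms(1) D(1)] evaluates_unique[OF assms(2) D(1)] show "z = v" by auto
  qed
qed

lemma evaluates_rec_0:
  assumes "evaluates a x v"
  shows "evaluates (code 6 a b) (pair 0 x) v"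
proof -
  obtain D where D: "computation D" "triple a x v \<in> D" using assms by (rule evaluatesE)
  show ?thesis
    by (rule evaluatesI[OF D(1)]) (use D assms evaluates_unique in \<open>auto simp: justified_simps\<close>)
qed

lemma evaluates_rec_Suc:
  assumes "evaluates (code 6 a b) (pair n x) u" "evaluates b (pair n (pair u x)) v"
  shows "evaluates (code 6 a b) (pair (Suc n) x) v"
proof -
  obtain D D' where D: "computation D" "triple (code 6 a b) (pair n x) u \<in> D"
    "computation D'" "triple b (pair n (pair u x)) v \<in> D'"
    using assms by (meson evaluatesE)
  show ?thesis
  proof (rule evaluatesI[OF computation_Un[OF D(1,3)]])
    show "justified (D \<union> D') (code 6 a b) (pair (Suc n) x) v"
      using D by (auto simp: justified_simps)
  next
    fix D z assume D: "computation D" "justified D (code 6 a b) (pair (Suc n) x) z"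
    then obtain w where "triple (code 6 a b) (pair n x) w \<in> D" "triple b (pair n (pair w x)) z \<in> D"
      by (auto simp: justified_simps)
    with evaluates_unique[OF assms(1) D(1)] evaluates_unique[OF assms(2) D(1)] show "z = v" by auto
  qed
qed

lemma evaluates_Least:
  assumes "evaluates a (pair y x) 0" "\<And>z. z < y \<Longrightarrow> \<exists>r. evaluates a (pair z x) (Suc r)"
  shows "evaluates (code 7 a b) x y"
proof -
  \<comment> \<open>The computations for all arguments below \<open>y\<close> are united into one,
    by induction on the bound.\<close>
  have "\<exists>D. computation D \<and> (\<forall>z<k. \<exists>r. triple a (pair z x) (Suc r) \<in> D)" if "k \<le> y" for k
    using that
  proof (induction k)
    case 0
    show ?case using computation_empty by auto
  next
    case (Suc k)
    then obtain D where D: "computation D" "\<forall>z<k. \<exists>r. triple a (pair z x) (Suc r) \<in> D" by auto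
    obtain r D' where D': "computation D'" "triple a (pair k x) (Suc r) \<in> D'"
      using assms(2)[of k] Suc.prems by (auto elim: evaluatesE)
    have "\<exists>r. triple a (pair z x) (Suc r) \<in> D \<union> D'" if "z < Suc k" for z
      using that D(2) D'(2) by (metis Un_iff less_SucE)
    then show ?case using computation_Un[OF D(1) D'(1)] by blast
  qed
  then obtain D where D: "computation D" "\<forall>z<y. \<exists>r. triple a (pair z x) (Suc r) \<in> D" by auto
  obtain D' where D': "computation D'" "triple a (pair y x) 0 \<in> D'"
    using assms(1) by (rule evaluatesE)
  show ?thesis
  proof (rule evaluatesI[OF computation_Un[OF D(1) D'(1)]])
    show "justified (D \<union> D') (code 7 a b) x y"
      using D(2) D'(2) by (auto simp: justified_simps)
  next
    fix D z assume D: "computation D" "justified D (code 7 a b) x z"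
    then have z: "triple a (pair z x) 0 \<in> D" "\<And>w. w < z \<Longrightarrow> \<exists>r. triple a (pair w x) (Suc r) \<in> D"
      by (auto simp: justified_simps)
    show "z = y"
    \<comment> \<open>A smaller \<open>z\<close> would have value 0 where \<open>assms(2)\<close>
      gives a successor; a larger \<open>z\<close> would need a successor at \<open>y\<close>, where
      \<open>assms(1)\<close> gives 0.\<close>
    proof (cases z y rule: linorder_cases)
      case less
      then show ?thesis using assms(2) z(1) evaluates_unique D(1) by blast
    next
      case greater
      then show ?thesis using assms(1) z(2) evaluates_unique D(1) by blast
    qed simp
  qed
qed

section \<open>Programs for all recursive functions\<close>

primrec list_code :: "nat list \<Rightarrow> nat" where
  "list_code [] = 0"
| "list_code (x # xs) = pair x (list_code xs)"

lemma program_nth: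
  "\<exists>e. \<forall>xs. i < length xs \<longrightarrow> evaluates e (list_code xs) (xs ! i)"
proof (induction i)
  case 0
  show ?case
  proof (intro exI[of _ "code 2 0 0"] allI impI)
    fix xs :: "nat list" assume "0 < length xs"
    then show "evaluates (code 2 0 0) (list_code xs) (xs ! 0)"
      using evaluates_p1[of 0 0 "list_code xs"] by (cases xs) auto
  qed
next
  case (Suc i)
  then obtain e where e: "\<And>xs. i < length xs \<Longrightarrow> evaluates e (list_code xs) (xs ! i)" by auto
  show ?case
  proof (intro exI[of _ "code 5 e (code 3 0 0)"] allI impI)
    fix xs :: "nat list" assume "Suc i < length xs"
    then obtain y ys where xs: "xs = y # ys" "i < length ys" by (cases xs) auto
    show "evaluates (code 5 e (code 3 0 0)) (list_code xs) (xs ! Suc i)"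
      using evaluates_p2[of 0 0 "list_code xs"] e[of ys] xs by (auto intro: evaluates_comp)
  qed
qed

text \<open>Each closure rule of \<open>recursive\<close> has a matching tag. The list code does not
  record the length (\<open>[]\<close> and \<open>[0]\<close> share the code 0), which is harmless
  because a program is asked about one arity only.\<close>

theorem program_exists:
  "recursive n f \<Longrightarrow> \<exists>e. \<forall>xs. length xs = n \<longrightarrow> evaluates e (list_code xs) (f xs)"
proof (induction rule: recursive.induct)
  case (zero n)
  show ?case using evaluates_zero by blast
next
  case succ
  obtain e where e: "\<And>xs. 0 < length xs \<Longrightarrow> evaluates e (list_code xs) (xs ! 0)"
    using program_nth by blast
  have "evaluates (code 5 (code 1 0 0) e) (list_code xs) (Suc (hd xs))" if "length xs = 1" for xs
    using that evaluates_comp[OF e evaluates_Suc, of xs] by (cases xs) auto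
  then show ?case by blast
next
  case (proj i n)
  then show ?case using program_nth[of i] by auto
next
  case (comp m g fs n)
  \<comment> \<open>One program produces the code of the whole list of inner values: tag 4 adds an
    entry in front, tag 0 gives the empty list.\<close>
  from comp.IH(2) have "\<exists>e. \<forall>xs. length xs = n \<longrightarrow>
      evaluates e (list_code xs) (list_code (map (\<lambda>f. f xs) fs))"
  proof (induction fs)
    case Nil
    show ?case using evaluates_zero by (simp; blast)
  next
    case (Cons f fs)
    then obtain a b where "\<forall>xs. length xs = n \<longrightarrow> evaluates a (list_code xs) (f xs)"
      "\<forall>xs. length xs = n \<longrightarrow> evaluates b (list_code xs) (list_code (map (\<lambda>f. f xs) fs))" by auto
    then show ?case by (intro exI[of _ "code 4 a b"]) (auto intro: evaluates_pair)
  qed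
  then obtain b where b: "\<And>xs. length xs = n \<Longrightarrow>
    evaluates b (list_code xs) (list_code (map (\<lambda>f. f xs) fs))" by auto
  obtain a where "\<forall>xs. length xs = m \<longrightarrow> evaluates a (list_code xs) (g xs)"
    using comp.IH(1) by auto
  with b comp.hyps show ?case
    by (intro exI[of _ "code 5 a b"]) (auto intro!: evaluates_comp[OF b])
next
  case (prim n g h)
  obtain a b where a: "\<And>xs. length xs = n \<Longrightarrow> evaluates a (list_code xs) (g xs)"
    and b: "\<And>xs. length xs = Suc (Suc n) \<Longrightarrow> evaluates b (list_code xs) (h xs)"
    using prim.IH by auto
  \<comment> \<open>The code of \<open>k # ys\<close> is \<open>pair k (list_code ys)\<close>, just
    the form of argument on which tag 6 recurses.\<close>
  have rec: "evaluates (code 6 a b) (pair k (list_code ys))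
      (rec_nat g (\<lambda>y r ys. h (y # r ys # ys)) k ys)" if "length ys = n" for k ys
  proof (induction k)
    case 0
    show ?case using evaluates_rec_0[OF a[OF that]] by simp
  next
    case (Suc k)
    show ?case
      using evaluates_rec_Suc[OF Suc] b[of "k # _ # ys"] that by simp
  qed
  show ?case
  proof (intro exI[of _ "code 6 a b"] allI impI)
    fix xs :: "nat list" assume "length xs = Suc n"
    then show "evaluates (code 6 a b) (list_code xs)
        (rec_nat g (\<lambda>y r ys. h (y # r ys # ys)) (hd xs) (tl xs))"
      using rec by (cases xs) auto
  qed
next
  case (mini n g)
  obtain a where a: "\<And>xs. length xs = Suc n \<Longrightarrow> evaluates a (list_code xs) (g xs)"
    using mini.IH by auto
  show ?case
  proof (intro exI[of _ "code 7 a 0"] allI impI)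
    fix xs :: "nat list" assume xs: "length xs = n"
    define y where "y = (LEAST y. g (y # xs) = 0)"
    have "g (y # xs) = 0" using mini.hyps(2) xs unfolding y_def by (metis (mono_tags, lifting) LeastI_ex)
    moreover have "\<exists>r. g (z # xs) = Suc r" if "z < y" for z
      using not_less_Least[of z "\<lambda>y. g (y # xs) = 0"] that unfolding y_def
      by (meson not0_implies_Suc)
    ultimately show "evaluates (code 7 a 0) (list_code xs) (LEAST y. g (y # xs) = 0)"
      unfolding y_def[symmetric]
      using a[of "_ # xs"] xs by (intro evaluates_Least) (metis length_Cons list_code.simps(2))+
  qed
qed

text \<open>\<open>d\<close> is a certificate: the binary code of a computation that contains the
  asserted value. With the certificate as an argument, halting becomes decidable.\<close>

definition halts :: "nat \<Rightarrow> nat \<Rightarrow> nat \<Rightarrow> nat \<Rightarrow> bool" where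
  "halts e x y d \<longleftrightarrow> computation (set_decode d) \<and> triple e (list_code [x]) y \<in> set_decode d"

text \<open>By the uniqueness in \<open>evaluates\<close> any certificate shows the true value of
  \<open>f\<close>, in particular the first one met in a search. The diagonal arguments below rely
  on this.\<close>

lemma index_exists:
  assumes "computable_fun f"
  obtains e where "\<And>x. \<exists>d. halts e x (f x) d" "\<And>x y d. halts e x y d \<Longrightarrow> y = f x"
proof -
  obtain e where e: "\<And>x. evaluates e (list_code [x]) (f x)"
    using assms program_exists unfolding computable_fun_def
    by (metis One_nat_def length_Cons list.size(3))
  have "\<exists>d. halts e x (f x) d" for x
  proof -
    obtain D where D: "computation D" "triple e (list_code [x]) (f x) \<in> D"
      using e by (rule evaluatesE)
    then have "set_decode (set_encode D) = D" by (simp add: computation_def)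
    with D show ?thesis unfolding halts_def by metis
  qed
  moreover have "y = f x" if "halts e x y d" for x y d
    using that e evaluates_unique unfolding halts_def by blast
  ultimately show thesis using that by blast
qed

lemma set_decode_less: "t \<in> set_decode d \<Longrightarrow> t < d"
proof -
  assume "t \<in> set_decode d"
  then have "d div 2 ^ t \<noteq> 0" unfolding set_decode_def by (metis even_zero mem_Collect_eq)
  then have "2 ^ t \<le> d" by (simp add: div_eq_0_iff)
  then show "t < d" by (rule less_le_trans[OF less_exp])
qed

lemma triple_set_decode_less:
  assumes "triple e x y \<in> set_decode d"
  shows "y < d"
proof -
  have "y \<le> triple e x y"
    unfolding triple_def using le_prod_encode_2 order_trans by metis
  then show ?thesis using set_decode_less[OF assms] by simp
qed

text \<open>The values quantified over without bound occur in triples of the set and are therefore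
  smaller than its code \<open>d\<close>. All quantifiers thus become bounded ones, which are
  decidable.\<close>

lemma justified_bounded:
  "justified (set_decode d) e x y \<longleftrightarrow> 
     (p1 e = 0 \<and> y = 0) \<or> (p1 e = 1 \<and> y = Suc x) \<or> (p1 e = 2 \<and> y = p1 x) \<or> (p1 e = 3 \<and> y = p2 x) \<or>
     (p1 e = 4 \<and> triple (p1 (p2 e)) x (p1 y) \<in> set_decode d \<and>
        triple (p2 (p2 e)) x (p2 y) \<in> set_decode d) \<or>
     (p1 e = 5 \<and> (\<exists>z<d. triple (p2 (p2 e)) x z \<in> set_decode d \<and>
        triple (p1 (p2 e)) z y \<in> set_decode d)) \<or>
     (p1 e = 6 \<and> p1 x = 0 \<and> triple (p1 (p2 e)) (p2 x) y \<in> set_decode d) \<or>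
     (p1 e = 6 \<and> p1 x \<noteq> 0 \<and> (\<exists>r<d. triple e (pair (p1 x - 1) (p2 x)) r \<in> set_decode d \<and>
        triple (p2 (p2 e)) (pair (p1 x - 1) (pair r (p2 x))) y \<in> set_decode d)) \<or>
     (p1 e = 7 \<and> triple (p1 (p2 e)) (pair y x) 0 \<in> set_decode d \<and>
        (\<forall>z<y. \<exists>r<d. triple (p1 (p2 e)) (pair z x) (Suc r) \<in> set_decode d))"
proof -
  have "(\<exists>z. triple a b z \<in> set_decode d \<and> P z) \<longleftrightarrow> (\<exists>z<d. triple a b z \<in> set_decode d \<and> P z)" for a b P
    using triple_set_decode_less by blast
  moreover have "(\<exists>r. triple a b (Suc r) \<in> set_decode d) \<longleftrightarrow>
      (\<exists>r<d. triple a b (Suc r) \<in> set_decode d)" for a b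
    using triple_set_decode_less Suc_lessD by blast
  ultimately show ?thesis unfolding justified_def Let_def by presburger
qed

lemma decidable_justified:
  assumes "computable_fun d" "computable_fun e" "computable_fun x" "computable_fun y"
  shows "decidable (\<lambda>n. justified (set_decode (d n)) (e n) (x n) (y n))"
  unfolding justified_bounded triple_def
  by (intro computable_intros decidable_set_decode assms[THEN computable_fun_compose] assms)

lemma decidable_halts:
  assumes "computable_fun e" "computable_fun x" "computable_fun y" "computable_fun d"
  shows "decidable (\<lambda>n. halts (e n) (x n) (y n) (d n))"
proof -
  have "computation (set_decode k) \<longleftrightarrow> (\<forall>t<k. t \<in> set_decode k \<longrightarrow>
      justified (set_decode k) (p1 t) (p1 (p2 t)) (p2 (p2 t)))" for k
    unfolding computation_def using set_decode_less by auto
  then show ?thesis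
    unfolding halts_def triple_def list_code.simps
    by (simp only:) (intro computable_intros decidable_set_decode decidable_justified
        assms[THEN computable_fun_compose] assms)
qed

section \<open>Computable embeddings of structures of bounded character\<close>

definition rank :: "(nat \<times> nat) set \<Rightarrow> nat \<Rightarrow> nat" where
  "rank E x = card {y. y < x \<and> (y, x) \<in> E}"

text \<open>Induction on \<open>r\<close>: the elements of \<open>C\<close> up to the one of rank
  \<open>r\<close> number only \<open>Suc r\<close>, so \<open>C\<close> has a larger element, and
  the least such has rank \<open>Suc r\<close>.\<close>

lemma ex_card_less_eq:
  fixes C :: "nat set"
  assumes "infinite C \<or> r < card C"
  shows "\<exists>y\<in>C. card {z. z < y \<and> z \<in> C} = r"
  using assms
proof (induction r)
  case 0
  then have "C \<noteq> {}" by auto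
  then have "(LEAST y. y \<in> C) \<in> C" by (meson LeastI_ex all_not_in_conv)
  moreover have "{z. z < (LEAST y. y \<in> C) \<and> z \<in> C} = {}" using not_less_Least by auto
  ultimately show ?case by (metis card.empty)
next
  case (Suc r)
  then obtain y where y: "y \<in> C" "card {z. z < y \<and> z \<in> C} = r" by auto
  have le: "{z. z \<le> y \<and> z \<in> C} = insert y {z. z < y \<and> z \<in> C}" using y(1) by auto
  then have "card {z. z \<le> y \<and> z \<in> C} = Suc r" using y(2) by simp
  then have "C \<noteq> {z. z \<le> y \<and> z \<in> C}"
    using Suc.prems by (metis finite_Collect_conjI finite_Collect_le_nat nat_neq_iff)
  then have ex: "\<exists>z. y < z \<and> z \<in> C" by (auto simp: not_le)
  define u where "u = (LEAST z. y < z \<and> z \<in> C)"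
  have u: "y < u" "u \<in> C" using LeastI_ex[OF ex] by (auto simp: u_def)
  have "z \<le> y" if "z < u" "z \<in> C" for z
    using not_less_Least[of z "\<lambda>z. y < z \<and> z \<in> C"] that by (auto simp: u_def)
  then have "{z. z < u \<and> z \<in> C} = {z. z \<le> y \<and> z \<in> C}" using u(1) by auto
  then have "card {z. z < u \<and> z \<in> C} = Suc r" using le y(2) by simp
  then show ?case using u(2) by blast
qed

lemma rel_in_carrier: "equiv A E \<Longrightarrow> (x, y) \<in> E \<Longrightarrow> x \<in> A \<and> y \<in> A"
  using equiv_type by blast

lemma rel_refl: "equiv A E \<Longrightarrow> x \<in> A \<Longrightarrow> (x, x) \<in> E"
  by (meson equivE refl_onD)

lemma rel_sym: "equiv A E \<Longrightarrow> (x, y) \<in> E \<Longrightarrow> (y, x) \<in> E"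
  by (meson equivE symD)

lemma rel_trans: "equiv A E \<Longrightarrow> (x, y) \<in> E \<Longrightarrow> (y, z) \<in> E \<Longrightarrow> (x, z) \<in> E"
  by (meson equivE transD)

lemma rank_eq_card:
  assumes "equiv A E"
  shows "rank E x = card {y. y < x \<and> y \<in> E `` {x}}"
  unfolding rank_def using rel_sym[OF assms] by (metis Image_singleton_iff)

lemma rank_inj:
  assumes equiv: "equiv A E" and "(x, y) \<in> E" "rank E x = rank E y"
  shows "x = y"
proof -
  have less: "rank E x < rank E y" if "x < y" "(x, y) \<in> E" for x y
    unfolding rank_def
    by (rule psubset_card_mono) (use that in \<open>auto intro: rel_trans[OF equiv]\<close>)
  show ?thesis
    using assms(2,3) less[of x y] less[of y x] rel_sym[OF equiv] by (metis nat_neq_iff)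
qed

lemma ex_rank_eq:
  assumes equiv: "equiv A E" and "infinite (E `` {x}) \<or> r < card (E `` {x})"
  shows "\<exists>y. (y, x) \<in> E \<and> rank E y = r"
proof -
  obtain y where y: "(x, y) \<in> E" "card {z. z < y \<and> z \<in> E `` {x}} = r"
    using ex_card_less_eq[OF assms(2)] by auto
  then have "E `` {y} = E `` {x}" using equiv_class_eq[OF equiv] by blast
  then show ?thesis using y rank_eq_card[OF equiv, of y] rel_sym[OF equiv] by auto
qed

lemma rank_less_card:
  assumes equiv: "equiv A E" and "x \<in> A" "finite (E `` {x})"
  shows "rank E x < card (E `` {x})"
  unfolding rank_eq_card[OF equiv]
  by (rule psubset_card_mono) (use assms rel_refl[OF equiv] in auto)

text \<open>It suffices to choose a sufficiently large target class for each class: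
  \<open>t x\<close> names it, and equality of ranks fixes the element in it. The premise
  \<open>x \<in> A\<close> inside \<open>LEAST\<close> makes the search succeed outside
  \<open>A\<close> too, as a total computable function requires.\<close>

lemma is_embedding_rank:
  assumes A: "equiv A E" and B: "equiv B F"
    and t: "\<And>x. x \<in> A \<Longrightarrow> t x \<in> B"
      "\<And>x y. x \<in> A \<Longrightarrow> y \<in> A \<Longrightarrow> (x, y) \<in> E \<longleftrightarrow> (t x, t y) \<in> F"
      "\<And>x. x \<in> A \<Longrightarrow> infinite (F `` {t x}) \<or> finite (E `` {x}) \<and> card (E `` {x}) \<le> card (F `` {t x})"
  shows "is_embedding (\<lambda>x. LEAST y. x \<in> A \<longrightarrow> (y, t x) \<in> F \<and> rank F y = rank E x) A E B F"
proof -
  let ?f = "\<lambda>x. LEAST y. x \<in> A \<longrightarrow> (y, t x) \<in> F \<and> rank F y = rank E x"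
  have f: "(?f x, t x) \<in> F \<and> rank F (?f x) = rank E x" if x: "x \<in> A" for x
  proof -
    have "infinite (F `` {t x}) \<or> rank E x < card (F `` {t x})"
      using t(3)[OF x] rank_less_card[OF A x] by auto
    from ex_rank_eq[OF B this]
    have "\<exists>y. x \<in> A \<longrightarrow> (y, t x) \<in> F \<and> rank F y = rank E x" by auto
    from LeastI_ex[OF this] x show ?thesis by (rule mp)
  qed
  have "(u, v) \<in> F \<longleftrightarrow> (u', v') \<in> F" if "(u, u') \<in> F" "(v, v') \<in> F" for u v u' v'
    using that rel_trans[OF B] rel_sym[OF B] by blast
  then have iff: "(x, y) \<in> E \<longleftrightarrow> (?f x, ?f y) \<in> F" if "x \<in> A" "y \<in> A" for x y
    unfolding t(2)[OF that] using f[OF that(1)] f[OF that(2)] by blast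
  show ?thesis unfolding is_embedding_def
  proof (intro conjI ballI inj_onI subsetI)
    fix y assume "y \<in> ?f ` A"
    then show "y \<in> B" using f rel_in_carrier[OF B] by blast
  next
    fix x y assume xy: "x \<in> A" "y \<in> A" "?f x = ?f y"
    have "(?f x, ?f x) \<in> F" using f[OF xy(1)] rel_in_carrier[OF B] rel_refl[OF B] by blast
    then have "(x, y) \<in> E" unfolding iff[OF xy(1,2)] using xy(3) by simp
    moreover have "rank E x = rank E y"
      using f[OF xy(1)] f[OF xy(2)] unfolding xy(3) by simp
    ultimately show "x = y" by (rule rank_inj[OF A])
  qed (use iff in auto)
qed

lemma computable_fun_rank:
  assumes "computable_rel E" "computable_fun f"
  shows "computable_fun (\<lambda>x. rank E (f x))"
proof (rule computable_fun_compose[OF _ assms(2)])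
  show "computable_fun (rank E)"
    unfolding rank_def[abs_def]
    by (intro computable_fun_card_less decidable_rel[OF assms(1)] computable_intros)
qed

lemma computably_embeds_rank:
  assumes A: "computable_eq_structure A E" and B: "computable_eq_structure B F"
    and t: "computable_fun t" "\<And>x. x \<in> A \<Longrightarrow> t x \<in> B"
      "\<And>x y. x \<in> A \<Longrightarrow> y \<in> A \<Longrightarrow> (x, y) \<in> E \<longleftrightarrow> (t x, t y) \<in> F"
      "\<And>x. x \<in> A \<Longrightarrow> infinite (F `` {t x}) \<or> finite (E `` {x}) \<and> card (E `` {x}) \<le> card (F `` {t x})"
  shows "computably_embeds A E B F"
proof -
  note c = A[unfolded computable_eq_structure_def eq_structure_def]
    B[unfolded computable_eq_structure_def eq_structure_def]
  have emb: "is_embedding (\<lambda>x. LEAST y. x \<in> A \<longrightarrow> (y, t x) \<in> F \<and> rank F y = rank E x) A E B F"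
    by (rule is_embedding_rank) (use c t in auto)
  have "computable_fun (\<lambda>x. LEAST y. x \<in> A \<longrightarrow> (y, t x) \<in> F \<and> rank F y = rank E x)"
  proof (rule computable_fun_Least)
    show "decidable (\<lambda>q. p1 q \<in> A \<longrightarrow> (p2 q, t (p1 q)) \<in> F \<and> rank F (p2 q) = rank E (p1 q))"
      using c by (intro decidable_mem decidable_rel computable_fun_rank computable_intros
        computable_fun_compose[OF t(1)]) auto
  next
    fix x
    have "infinite (F `` {t x}) \<or> rank E x < card (F `` {t x})" if "x \<in> A"
      using t(4)[OF that] rank_less_card[of A E x] that c by auto
    then show "\<exists>y. x \<in> A \<longrightarrow> (y, t x) \<in> F \<and> rank F y = rank E x"
      using ex_rank_eq[of B F "t x" "rank E x"] c by blast
  qed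
  with emb show ?thesis unfolding computably_embeds_def by blast
qed

section \<open>Finite tables and enumeration of decidable sets\<close>

lemma decidable_ball_finite:
  assumes "finite R" "\<And>a. a \<in> R \<Longrightarrow> decidable (\<lambda>x. P x a)"
  shows "decidable (\<lambda>x. \<forall>a\<in>R. P x a)"
  using assms
proof (induction R)
  case empty
  show ?case using decidable_le[OF computable_fun_id computable_fun_id] by simp
next
  case (insert a R)
  then show ?case by (simp add: decidable_conj)
qed

text \<open>The arbitrary function \<open>f\<close> enters only through its finitely many values on
  \<open>R\<close>, which are written into the program as constants.\<close>

lemma computable_lookup:
  assumes "finite R" "\<And>a. a \<in> R \<Longrightarrow> decidable (\<lambda>x. P x a)" "computable_fun g"
  obtains t where "computable_fun t"
    "\<And>x. (\<exists>a\<in>R. P x a \<and> t x = f a) \<or> (\<forall>a\<in>R. \<not> P x a) \<and> t x = g x"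
proof -
  have "\<exists>t. computable_fun t \<and>
      (\<forall>x. (\<exists>a\<in>R. P x a \<and> t x = f a) \<or> (\<forall>a\<in>R. \<not> P x a) \<and> t x = g x)"
    using assms(1,2)
  proof (induction R)
    case empty
    show ?case using assms(3) by auto
  next
    case (insert a R)
    then obtain t where t: "computable_fun t"
      "\<And>x. (\<exists>a\<in>R. P x a \<and> t x = f a) \<or> (\<forall>a\<in>R. \<not> P x a) \<and> t x = g x" by auto
    show ?case
    proof (intro exI[of _ "\<lambda>x. if P x a then f a else t x"] conjI allI)
      show "computable_fun (\<lambda>x. if P x a then f a else t x)"
        using insert.prems by (intro computable_fun_if t(1) computable_fun_const) auto
      show "(\<exists>b\<in>insert a R. P x b \<and> (if P x a then f a else t x) = f b) \<or>
          (\<forall>b\<in>insert a R. \<not> P x b) \<and> (if P x a then f a else t x) = g x" for x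
        using t(2)[of x] by auto
    qed
  qed
  then show thesis using that by blast
qed

text \<open>\<open>e n\<close> is the element of \<open>Z\<close> with exactly \<open>n\<close>
  smaller ones; it is found by search, which ends because \<open>Z\<close> is infinite.\<close>

lemma decidable_infinite_enumeration:
  assumes "decidable (\<lambda>x. x \<in> Z)" "infinite Z"
  obtains e where "computable_fun e" "inj e" "range e \<subseteq> Z"
proof -
  define e where "e n = (LEAST z. z \<in> Z \<and> card {y. y < z \<and> y \<in> Z} = n)" for n
  have ex: "\<exists>z. z \<in> Z \<and> card {y. y < z \<and> y \<in> Z} = n" for n
    using ex_card_less_eq[of Z n] assms(2) by auto
  have e: "e n \<in> Z \<and> card {y. y < e n \<and> y \<in> Z} = n" for n
    unfolding e_def by (rule LeastI_ex[OF ex])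
  have "computable_fun (\<lambda>n. LEAST z. z \<in> Z \<and> card {y. y < z \<and> y \<in> Z} = n)"
    by (rule computable_fun_Least, intro decidable_compose[OF assms(1)] computable_fun_card_less
        computable_intros) (rule ex)
  then have "computable_fun e" by (simp add: e_def[abs_def])
  moreover have "inj e" using e by (metis injI)
  ultimately show thesis using that e by blast
qed

lemma is_embedding_card_class:
  assumes f: "is_embedding f A E B F" and A: "equiv A E" and x: "x \<in> A"
  shows "infinite (F `` {f x}) \<or> finite (E `` {x}) \<and> card (E `` {x}) \<le> card (F `` {f x})"
proof -
  have sub: "E `` {x} \<subseteq> A" using rel_in_carrier[OF A] by auto
  have inj: "inj_on f (E `` {x})" using f sub unfolding is_embedding_def by (meson inj_on_subset)
  have img: "f ` (E `` {x}) \<subseteq> F `` {f x}" using f x sub unfolding is_embedding_def by blast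
  show ?thesis using inj_on_finite[OF inj img] card_inj_on_le[OF inj img] by auto
qed

text \<open>The given embedding \<open>f\<close> is non-effective. It is used on finitely many
  representatives only, and as evidence that \<open>B\<close> has enough further classes.\<close>

lemma computably_embedsI:
  assumes A: "computable_eq_structure A E" and B: "computable_eq_structure B F"
    and fin: "finitely_many_infinite_classes A E" and bdd: "bounded_character A E"
    and emb: "embeds A E B F"
  shows "computably_embeds A E B F"
proof -
  have eqA: "equiv A E" and eqB: "equiv B F" and cE: "computable_rel E" and cF: "computable_rel F"
    and cB: "computable_set B"
    using A B by (auto simp: computable_eq_structure_def eq_structure_def)
  obtain f where f: "is_embedding f A E B F" using emb unfolding embeds_def by blast
  have fB: "\<And>x. x \<in> A \<Longrightarrow> f x \<in> B"
    and fE: "\<And>x y. x \<in> A \<Longrightarrow> y \<in> A \<Longrightarrow> (x, y) \<in> E \<longleftrightarrow> (f x, f y) \<in> F"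
    using f unfolding is_embedding_def by blast+
  \<comment> \<open>\<open>l\<close> is the least number exceeded in size by only finitely many
    finite classes; bounded character supplies a candidate.\<close>
  define l where "l = (LEAST l. finite {C \<in> A // E. finite C \<and> l < card C})"
  obtain k where "\<And>C. C \<in> A // E \<Longrightarrow> finite C \<Longrightarrow> card C \<le> k"
    using bdd unfolding bounded_character_def by blast
  then have "{C \<in> A // E. finite C \<and> k < card C} = {}" by fastforce
  then have "\<exists>l. finite {C \<in> A // E. finite C \<and> l < card C}" by (metis finite.emptyI)
  then have l_fin: "finite {C \<in> A // E. finite C \<and> l < card C}"
    unfolding l_def by (rule LeastI_ex)
  \<comment> \<open>If only finitely many classes had size \<open>l\<close>, then
    \<open>l - 1\<close> would already qualify, against minimality.\<close>
  have l_inf: "infinite {C \<in> A // E. finite C \<and> card C = l}" if "0 < l"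
  proof
    assume "finite {C \<in> A // E. finite C \<and> card C = l}"
    from finite_UnI[OF this l_fin] have "finite {C \<in> A // E. finite C \<and> l - 1 < card C}"
      by (rule rev_finite_subset) auto
    then have "l \<le> l - 1" by (subst l_def) (rule Least_le)
    then show False using that by simp
  qed
  \<comment> \<open>These are the exceptional classes. By the choice of \<open>l\<close> there are
    finitely many, so one representative of each, collected in \<open>R\<close>, can be tabulated
    with its value under \<open>f\<close>.\<close>
  define big where "big C \<longleftrightarrow> infinite C \<or> l < card C" for C :: "nat set"
  define R where "R = (\<lambda>C. SOME a. a \<in> C) ` {C \<in> A // E. big C}"
  have "{C \<in> A // E. big C} =
      {C \<in> A // E. infinite C} \<union> {C \<in> A // E. finite C \<and> l < card C}"
    unfolding big_def by auto
  then have finR: "finite R"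
    using fin l_fin unfolding R_def finitely_many_infinite_classes_def by simp
  have cover: "\<exists>a\<in>R. (x, a) \<in> E" if "x \<in> A" "big (E `` {x})" for x
  proof -
    have "(SOME a. a \<in> E `` {x}) \<in> E `` {x}"
      by (rule someI[of _ x]) (simp add: rel_refl[OF eqA that(1)])
    moreover have "(SOME a. a \<in> E `` {x}) \<in> R"
      unfolding R_def by (rule imageI) (simp add: that quotientI)
    ultimately show ?thesis by auto
  qed
  have RA: "R \<subseteq> A"
  proof
    fix a assume "a \<in> R"
    then obtain C where C: "C \<in> A // E" "a = (SOME a. a \<in> C)" unfolding R_def by auto
    then have "a \<in> C" using in_quotient_imp_non_empty[OF eqA] by (metis ex_in_conv someI)
    then show "a \<in> A" using C(1) in_quotient_imp_subset[OF eqA] by blast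
  qed
  have R_big: "big (E `` {a})" if "a \<in> R" for a
  proof -
    obtain C where C: "C \<in> A // E" "big C" "a = (SOME a. a \<in> C)" using \<open>a \<in> R\<close> unfolding R_def by auto
    then have "a \<in> C" using in_quotient_imp_non_empty[OF eqA] by (metis ex_in_conv someI)
    moreover obtain c where "C = E `` {c}" using C(1) by (meson quotientE)
    ultimately have "C = E `` {a}" using equiv_class_eq[OF eqA] by blast
    then show ?thesis using C(2) by simp
  qed
  txt \<open>The elements of rank \<open>l - 1\<close> form a transversal of the classes with at least \<open>l\<close> elements.\<close>
  define Z where "Z = {z \<in> B. rank F z = l - 1 \<and> (\<forall>a\<in>R. (z, f a) \<notin> F)}"
  have decZ: "decidable (\<lambda>z. z \<in> Z)"
    unfolding Z_def using cB cF finR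
    by (simp, intro decidable_conj decidable_mem decidable_eq decidable_ball_finite decidable_not
        decidable_rel computable_fun_rank computable_intros)
  have Z_card: "infinite (F `` {z}) \<or> l \<le> card (F `` {z})" if "z \<in> Z" for z
    using that rank_less_card[OF eqB, of z] unfolding Z_def by auto
  \<comment> \<open>Each of the infinitely many classes of size \<open>l\<close> has an image class
    with at least \<open>l\<close> elements, hence with one of rank \<open>l - 1\<close>. That image
    differs from the images of exceptional classes, and distinct classes yield distinct elements of
    \<open>Z\<close>.\<close>
  have infZ: "infinite Z" if "0 < l"
  proof
    assume finZ: "finite Z"
    define S where "S = {C \<in> A // E. finite C \<and> card C = l}"
    have "\<exists>x z. x \<in> A \<and> C = E `` {x} \<and> z \<in> Z \<and> (z, f x) \<in> F" if "C \<in> S" for C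
    proof -
      obtain x where x: "x \<in> A" "C = E `` {x}" using \<open>C \<in> S\<close> unfolding S_def by (auto elim: quotientE)
      have "infinite (F `` {f x}) \<or> l - 1 < card (F `` {f x})"
        using is_embedding_card_class[OF f eqA x(1)] that x(2) \<open>0 < l\<close> unfolding S_def by auto
      then obtain z where z: "(z, f x) \<in> F" "rank F z = l - 1" using ex_rank_eq[OF eqB] by blast
      have "(z, f a) \<notin> F" if "a \<in> R" for a
      proof
        assume "(z, f a) \<in> F"
        then have "(f x, f a) \<in> F" using z(1) rel_trans[OF eqB] rel_sym[OF eqB] by blast
        then have "E `` {x} = E `` {a}" using fE x(1) that RA equiv_class_eq[OF eqA] by blast
        then show False using R_big[OF that] x(2) \<open>C \<in> S\<close> unfolding S_def big_def by auto
      qed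
      then have "z \<in> Z" unfolding Z_def using z rel_in_carrier[OF eqB] by auto
      then show ?thesis using x z(1) by blast
    qed
    then obtain x z where xz: "\<And>C. C \<in> S \<Longrightarrow> x C \<in> A \<and> C = E `` {x C} \<and> z C \<in> Z \<and> (z C, f (x C)) \<in> F"
      by metis
    have "inj_on z S"
    proof (rule inj_onI)
      fix C D assume CD: "C \<in> S" "D \<in> S" "z C = z D"
      then have "(f (x C), f (x D)) \<in> F" using xz rel_trans[OF eqB] rel_sym[OF eqB] by metis
      then have "E `` {x C} = E `` {x D}" using fE xz CD equiv_class_eq[OF eqA] by blast
      then show "C = D" using xz CD by metis
    qed
    moreover have "z ` S \<subseteq> Z" using xz by auto
    ultimately have "finite S" using finZ by (meson inj_on_finite)
    then show False using l_inf[OF that] unfolding S_def by simp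
  qed
  \<comment> \<open>For \<open>l = 0\<close> the function \<open>e\<close> is a placeholder: classes
    are non-empty, so all of them are then exceptional.\<close>
  obtain e where e: "computable_fun e" "0 < l \<Longrightarrow> inj e" "0 < l \<Longrightarrow> range e \<subseteq> Z"
  proof (cases "0 < l")
    case True
    then show ?thesis using decidable_infinite_enumeration[OF decZ infZ] that by metis
  next
    case False
    then show ?thesis using that computable_fun_id by blast
  qed
  \<comment> \<open>On \<open>A\<close> this is the least element of the class, a canonical name for
    it; the disjunct \<open>y = x\<close> ends the search outside \<open>A\<close>.\<close>
  define m where "m x = (LEAST y. y = x \<or> (x, y) \<in> E)" for x
  have cm: "computable_fun (\<lambda>x. LEAST y. y = x \<or> (x, y) \<in> E)"
    using cE by (intro computable_fun_Least decidable_rel computable_intros) auto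
  have mE: "(x, m x) \<in> E" if "x \<in> A" for x
    using LeastI[of "\<lambda>y. y = x \<or> (x, y) \<in> E" x] rel_refl[OF eqA that] unfolding m_def by metis
  have m_eq: "m x = m y" if "(x, y) \<in> E" for x y
  proof -
    have "(z = x \<or> (x, z) \<in> E) \<longleftrightarrow> (z = y \<or> (y, z) \<in> E)" for z
      using that rel_trans[OF eqA] rel_sym[OF eqA] rel_refl[OF eqA] rel_in_carrier[OF eqA] by metis
    then show ?thesis unfolding m_def by simp
  qed
  \<comment> \<open>Exceptional classes follow \<open>f\<close>; any other class is sent to the
    element of \<open>Z\<close> which \<open>e\<close> assigns to its name.\<close>
  obtain t where t: "computable_fun t"
    "\<And>x. (\<exists>a\<in>R. (x, a) \<in> E \<and> t x = f a) \<or> (\<forall>a\<in>R. (x, a) \<notin> E) \<and> t x = e (m x)"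
  proof (rule computable_lookup[OF finR, where P = "\<lambda>x a. (x, a) \<in> E" and f = f])
    show "decidable (\<lambda>x. (x, a) \<in> E)" for a by (intro decidable_rel cE computable_intros)
    show "computable_fun (\<lambda>x. e (m x))"
      unfolding m_def by (rule computable_fun_compose[OF e(1) cm])
  qed blast
  have uncov: "0 < l \<and> finite (E `` {x}) \<and> card (E `` {x}) \<le> l"
    if "x \<in> A" "\<forall>a\<in>R. (x, a) \<notin> E" for x
  proof -
    have "\<not> big (E `` {x})" using cover that by blast
    then show ?thesis using rank_less_card[OF eqA that(1)] unfolding big_def by auto
  qed
  have tZ: "t x \<in> Z \<and> t x = e (m x)" if "x \<in> A" "\<forall>a\<in>R. (x, a) \<notin> E" for x
    using t(2)[of x] e(3) uncov[OF that] that by blast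
  show ?thesis
  proof (rule computably_embeds_rank[OF A B t(1)])
    fix x assume x: "x \<in> A"
    consider a where "a \<in> R" "(x, a) \<in> E" "t x = f a" | "\<forall>a\<in>R. (x, a) \<notin> E" using t(2) by blast
    then show "t x \<in> B"
      using fB RA tZ[OF x] unfolding Z_def by cases auto
    consider a where "a \<in> R" "(x, a) \<in> E" "t x = f a" | "\<forall>a\<in>R. (x, a) \<notin> E" using t(2) by blast
    then show "infinite (F `` {t x}) \<or> finite (E `` {x}) \<and> card (E `` {x}) \<le> card (F `` {t x})"
    proof cases
      case 1
      then have "E `` {x} = E `` {a}" using equiv_class_eq[OF eqA] by blast
      then show ?thesis using is_embedding_card_class[OF f eqA, of a] 1 RA by auto
    next
      case 2
      then show ?thesis using uncov[OF x] Z_card[of "t x"] tZ[OF x] by auto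
    qed
  next
    fix x y assume x: "x \<in> A" and y: "y \<in> A"
    have mixed: "(x, y) \<notin> E \<and> (t x, t y) \<notin> F \<and> (t y, t x) \<notin> F"
      if "a \<in> R" "(x, a) \<in> E" "t x = f a" "y \<in> A" "\<forall>a\<in>R. (y, a) \<notin> E" for x y a
      using that tZ[OF that(4,5)] rel_trans[OF eqA] rel_sym[OF eqA] rel_sym[OF eqB]
      unfolding Z_def by (metis (no_types, lifting) mem_Collect_eq)
    consider a b where "a \<in> R" "(x, a) \<in> E" "t x = f a" "b \<in> R" "(y, b) \<in> E" "t y = f b"
      | a where "a \<in> R" "(x, a) \<in> E" "t x = f a" "\<forall>a\<in>R. (y, a) \<notin> E"
      | a where "a \<in> R" "(y, a) \<in> E" "t y = f a" "\<forall>a\<in>R. (x, a) \<notin> E"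
      | "\<forall>a\<in>R. (x, a) \<notin> E" "\<forall>a\<in>R. (y, a) \<notin> E"
      using t(2)[of x] t(2)[of y] by blast
    then show "(x, y) \<in> E \<longleftrightarrow> (t x, t y) \<in> F"
    proof cases
      case 1
      then have "(x, y) \<in> E \<longleftrightarrow> (a, b) \<in> E" using rel_trans[OF eqA] rel_sym[OF eqA] by meson
      then show ?thesis using fE[of a b] 1 RA by auto
    next
      case 2
      then show ?thesis using mixed y by blast
    next
      case 3
      then show ?thesis using mixed x rel_sym[OF eqA] by blast
    next
      case 4
      show ?thesis
      proof
        assume "(x, y) \<in> E"
        then have "t x = t y" using m_eq tZ x y 4 by simp
        then show "(t x, t y) \<in> F" using rel_refl[OF eqB] tZ[OF x 4(1)] unfolding Z_def by auto
      next
        \<comment> \<open>Elements of \<open>Z\<close> all have rank \<open>l - 1\<close>, so two of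
          them in one class coincide; injectivity of \<open>e\<close> then gives equal
          names.\<close>
        assume F: "(t x, t y) \<in> F"
        have "rank F (t x) = l - 1" "rank F (t y) = l - 1"
          using tZ[OF x 4(1)] tZ[OF y 4(2)] unfolding Z_def by blast+
        then have "t x = t y" using rank_inj[OF eqB F] by simp
        then have "m x = m y"
          using tZ[OF x 4(1)] tZ[OF y 4(2)] e(2) uncov[OF x 4(1)] by (metis injD)
        then show "(x, y) \<in> E" using mE[OF x] mE[OF y] rel_trans[OF eqA] rel_sym[OF eqA] by metis
      qed
    qed
  qed
qed

section \<open>Embeddings obtained by matching classes\<close>

text \<open>Embeddability depends only on the sizes of classes: an injection of classes that never
  shrinks a class is turned into an embedding by choosing a point in each target class and matching
  ranks.\<close>

lemma embeds_classes:
  assumes A: "equiv A E" and B: "equiv B F"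
    and \<Phi>: "inj_on \<Phi> (A // E)" "\<And>C. C \<in> A // E \<Longrightarrow> \<Phi> C \<in> B // F"
      "\<And>C. C \<in> A // E \<Longrightarrow> infinite (\<Phi> C) \<or> finite C \<and> card C \<le> card (\<Phi> C)"
  shows "embeds A E B F"
proof -
  define t where "t x = (SOME b. b \<in> \<Phi> (E `` {x}))" for x
  have t: "t x \<in> \<Phi> (E `` {x}) \<and> F `` {t x} = \<Phi> (E `` {x})" if x: "x \<in> A" for x
  proof -
    have q: "\<Phi> (E `` {x}) \<in> B // F" using \<Phi>(2) quotientI[OF x] by blast
    then have "t x \<in> \<Phi> (E `` {x})"
      unfolding t_def using in_quotient_imp_non_empty[OF B] by (metis ex_in_conv someI)
    moreover obtain b where "\<Phi> (E `` {x}) = F `` {b}" using q by (rule quotientE)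
    ultimately show ?thesis using equiv_class_eq[OF B] by blast
  qed
  have tB: "t x \<in> B" if "x \<in> A" for x
    using t[OF that] in_quotient_imp_subset[OF B \<Phi>(2)[OF quotientI[OF that]]] by blast
  have "(x, y) \<in> E \<longleftrightarrow> (t x, t y) \<in> F" if "x \<in> A" "y \<in> A" for x y
  proof -
    have "(x, y) \<in> E \<longleftrightarrow> E `` {x} = E `` {y}" using eq_equiv_class_iff[OF A that] by simp
    also have "\<dots> \<longleftrightarrow> \<Phi> (E `` {x}) = \<Phi> (E `` {y})"
      using \<Phi>(1) quotientI[OF that(1)] quotientI[OF that(2)] by (auto dest: inj_onD)
    also have "\<dots> \<longleftrightarrow> F `` {t x} = F `` {t y}" using t that by simp
    also have "\<dots> \<longleftrightarrow> (t x, t y) \<in> F" using eq_equiv_class_iff[OF B] tB that by simp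
    finally show ?thesis .
  qed
  moreover have "infinite (F `` {t x}) \<or> finite (E `` {x}) \<and> card (E `` {x}) \<le> card (F `` {t x})"
    if "x \<in> A" for x
    using \<Phi>(3)[OF quotientI[OF that]] t[OF that] by simp
  ultimately have
    "is_embedding (\<lambda>x. LEAST y. x \<in> A \<longrightarrow> (y, t x) \<in> F \<and> rank F y = rank E x) A E B F"
    using tB by (intro is_embedding_rank A B)
  then show ?thesis unfolding embeds_def by blast
qed

lemma inj_on_Least_quotient:
  assumes A: "equiv A E"
  shows "inj_on (\<lambda>C. LEAST x::nat. x \<in> C) (A // E)"
proof (rule inj_onI)
  fix C D assume CD: "C \<in> A // E" "D \<in> A // E" "(LEAST x. x \<in> C) = (LEAST x. x \<in> D)"
  have "(LEAST x. x \<in> C) \<in> C" if "C \<in> A // E" for C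
    using in_quotient_imp_non_empty[OF A that] by (meson LeastI_ex ex_in_conv)
  then show "C = D" using CD quotient_disj[OF A CD(1,2)] by (metis disjoint_iff)
qed

text \<open>There are only countably many classes to place, numbered by their least elements, and
  each gets an infinite class of its own.\<close>

lemma embeds_infinitely_many:
  assumes A: "equiv A E" and B: "equiv B F" and inf: "\<not> finitely_many_infinite_classes B F"
  shows "embeds A E B F"
proof -
  obtain h :: "nat \<Rightarrow> nat set" where h: "inj h" "range h \<subseteq> {C \<in> B // F. infinite C}"
    using inf infinite_countable_subset unfolding finitely_many_infinite_classes_def by blast
  then have h': "h n \<in> B // F" "infinite (h n)" for n by auto
  have "inj_on (\<lambda>C. h (LEAST x. x \<in> C)) (A // E)"
    using inj_on_Least_quotient[OF A] h(1) unfolding inj_on_def by blast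
  then show ?thesis using h' by (intro embeds_classes[OF A B]) auto
qed

text \<open>Infinite classes are matched by counting. Finite classes go to finite classes
  \<open>D n\<close> of strictly increasing size, so both kinds of images stay apart.\<close>

lemma embeds_unbounded:
  assumes A: "equiv A E" and B: "equiv B F"
    and fin: "finite {C \<in> A // E. infinite C}"
    and card: "card {C \<in> A // E. infinite C} \<le> card {C \<in> B // F. infinite C}"
    and unb: "\<not> bounded_character B F"
  shows "embeds A E B F"
proof -
  have "\<exists>g. inj_on g {C \<in> A // E. infinite C} \<and>
      g ` {C \<in> A // E. infinite C} \<subseteq> {C \<in> B // F. infinite C}"
  proof (cases "finite {C \<in> B // F. infinite C}")
    case True
    show ?thesis using card_le_inj[OF fin True card] by blast
  next
    case False
    obtain S where S: "finite S" "card S = card {C \<in> A // E. infinite C}"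
      "S \<subseteq> {C \<in> B // F. infinite C}"
      using infinite_arbitrarily_large[OF False] by blast
    obtain g where "bij_betw g {C \<in> A // E. infinite C} S"
      using finite_same_card_bij[OF fin S(1) S(2)[symmetric]] by blast
    with S(3) show ?thesis unfolding bij_betw_def by blast
  qed
  then obtain g where g: "inj_on g {C \<in> A // E. infinite C}"
    "g ` {C \<in> A // E. infinite C} \<subseteq> {C \<in> B // F. infinite C}" by blast
  define K where "K = card ` {C \<in> B // F. finite C}"
  have "\<exists>n>k. n \<in> K" for k
  proof -
    obtain C where "C \<in> B // F" "finite C" "\<not> card C \<le> k"
      using unb unfolding bounded_character_def by blast
    then show ?thesis unfolding K_def by (intro exI[of _ "card C"]) auto
  qed
  then have infK: "infinite K" by (simp add: infinite_nat_iff_unbounded)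
  have "\<exists>D. D \<in> B // F \<and> finite D \<and> card D = n" if "n \<in> K" for n
    using that unfolding K_def by blast
  then have "\<forall>n. \<exists>D. D \<in> B // F \<and> finite D \<and> card D = enumerate K n"
    using enumerate_in_set[OF infK] by blast
  from choice[OF this] obtain D where D: "\<And>n. D n \<in> B // F" "\<And>n. finite (D n)"
    "\<And>n. card (D n) = enumerate K n"
    by blast
  have injD: "D i = D j \<Longrightarrow> i = j" for i j
    using D(3)[of i] D(3)[of j] strict_mono_eq[OF strict_mono_enumerate[OF infK], of i j] by simp
  have leD: "n \<le> card (D n)" for n
    unfolding D(3) by (rule strict_mono_imp_increasing[OF strict_mono_enumerate[OF infK]])
  \<comment> \<open>The index contains the least element, which separates distinct classes, and is
    at least \<open>card C\<close>; since \<open>D n\<close> has at least \<open>n\<close> elements,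
    there is room for \<open>C\<close>.\<close>
  define \<Phi> where "\<Phi> C = (if infinite C then g C else D (pair (LEAST x. x \<in> C) (card C)))" for C
  show ?thesis
  proof (rule embeds_classes[OF A B, of \<Phi>])
    have fin_iff: "finite (\<Phi> C) \<longleftrightarrow> finite C" if "C \<in> A // E" for C
      using that g(2) D(2) unfolding \<Phi>_def by auto
    show "inj_on \<Phi> (A // E)"
    proof (rule inj_onI)
      fix C C' assume C: "C \<in> A // E" "C' \<in> A // E" "\<Phi> C = \<Phi> C'"
      then have iff: "finite C \<longleftrightarrow> finite C'" using fin_iff by metis
      show "C = C'"
      proof (cases "finite C")
        case True
        then have "D (pair (LEAST x. x \<in> C) (card C)) = D (pair (LEAST x. x \<in> C') (card C'))"
          using C(3) iff unfolding \<Phi>_def by simp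
        from injD[OF this] have "(LEAST x. x \<in> C) = (LEAST x. x \<in> C')" by simp
        then show ?thesis using inj_onD[OF inj_on_Least_quotient[OF A]] C(1,2) by blast
      next
        case False
        then have "g C = g C'" using C(3) iff unfolding \<Phi>_def by simp
        then show ?thesis using inj_onD[OF g(1)] C(1,2) False iff by blast
      qed
    qed
    fix C assume C: "C \<in> A // E"
    show "\<Phi> C \<in> B // F" using C D(1) g(2) unfolding \<Phi>_def by auto
    have "card C \<le> card (D (pair (LEAST x. x \<in> C) (card C)))"
      by (rule order_trans[OF le_prod_encode_2 leD])
    then show "infinite (\<Phi> C) \<or> finite C \<and> card C \<le> card (\<Phi> C)"
      using fin_iff[OF C] unfolding \<Phi>_def by auto
  qed
qed

section \<open>The effect of an embedding on the number of infinite classes\<close>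

lemma inj_on_class_image:
  assumes f: "is_embedding f A E B F" and A: "equiv A E" and B: "equiv B F"
  obtains g where "inj_on g (A // E)" "\<And>x. x \<in> A \<Longrightarrow> g (E `` {x}) = F `` {f x}"
    "g ` {C \<in> A // E. infinite C} \<subseteq> {C \<in> B // F. infinite C}"
proof -
  have fB: "f x \<in> B" if "x \<in> A" for x using f that unfolding is_embedding_def by blast
  have fE: "(x, y) \<in> E \<longleftrightarrow> (f x, f y) \<in> F" if "x \<in> A" "y \<in> A" for x y
    using f that unfolding is_embedding_def by blast
  \<comment> \<open>The choice of representative does not matter, since \<open>f\<close> sends
    equivalent elements to equivalent ones.\<close>
  define g where "g C = F `` {f (SOME x. x \<in> C)}" for C
  have g: "g (E `` {x}) = F `` {f x}" if "x \<in> A" for x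
  proof -
    have "(SOME y. y \<in> E `` {x}) \<in> E `` {x}"
      by (rule someI[of _ x]) (simp add: rel_refl[OF A that])
    then have "(f x, f (SOME y. y \<in> E `` {x})) \<in> F"
      using fE[OF that] rel_in_carrier[OF A] by blast
    then show ?thesis unfolding g_def using equiv_class_eq[OF B] by blast
  qed
  have "inj_on g (A // E)"
  proof (rule inj_onI)
    fix C D assume "C \<in> A // E" "D \<in> A // E" "g C = g D"
    then obtain x y where xy: "C = E `` {x}" "D = E `` {y}" "x \<in> A" "y \<in> A" "g C = g D"
      by (metis quotientE)
    then have "F `` {f x} = F `` {f y}" using g by simp
    then have "(x, y) \<in> E" using eq_equiv_class_iff[OF B fB fB] fE xy(3,4) by blast
    then show "C = D" using xy equiv_class_eq[OF A] by simp
  qed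
  moreover have "g ` {C \<in> A // E. infinite C} \<subseteq> {C \<in> B // F. infinite C}"
  proof
    fix D assume "D \<in> g ` {C \<in> A // E. infinite C}"
    then obtain x where x: "x \<in> A" "infinite (E `` {x})" "D = g (E `` {x})"
      by (auto elim!: quotientE)
    then show "D \<in> {C \<in> B // F. infinite C}"
      using g[OF x(1)] quotientI[OF fB[OF x(1)]] is_embedding_card_class[OF f A x(1)] by simp
  qed
  ultimately show thesis using that g by blast
qed

lemma embeds_infinite_classes:
  assumes "embeds A E B F" and A: "equiv A E" and B: "equiv B F"
    and fin: "finitely_many_infinite_classes B F"
  shows "finitely_many_infinite_classes A E"
    "card {C \<in> A // E. infinite C} \<le> card {C \<in> B // F. infinite C}"
proof -
  obtain f where f: "is_embedding f A E B F" using assms(1) unfolding embeds_def by blast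
  obtain g where g: "inj_on g (A // E)"
    "g ` {C \<in> A // E. infinite C} \<subseteq> {C \<in> B // F. infinite C}"
    by (rule inj_on_class_image[OF f A B]) blast
  have inj: "inj_on g {C \<in> A // E. infinite C}" using g(1) by (rule inj_on_subset) auto
  show "finitely_many_infinite_classes A E"
    using inj_on_finite[OF inj g(2)] fin unfolding finitely_many_infinite_classes_def by blast
  show "card {C \<in> A // E. infinite C} \<le> card {C \<in> B // F. infinite C}"
    using card_inj_on_le[OF inj g(2)] fin unfolding finitely_many_infinite_classes_def by blast
qed

text \<open>By the pigeonhole principle all infinite classes of the target are already taken by infinite
  classes.\<close>

lemma is_embedding_finite_class:
  assumes f: "is_embedding f A E B F" and A: "equiv A E" and B: "equiv B F"
    and fin: "finitely_many_infinite_classes B F"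
    and card: "card {C \<in> B // F. infinite C} \<le> card {C \<in> A // E. infinite C}"
    and x: "x \<in> A" "finite (E `` {x})"
  shows "finite (F `` {f x})"
proof (rule ccontr)
  assume inf: "infinite (F `` {f x})"
  obtain g where g: "inj_on g (A // E)" "\<And>x. x \<in> A \<Longrightarrow> g (E `` {x}) = F `` {f x}"
    "g ` {C \<in> A // E. infinite C} \<subseteq> {C \<in> B // F. infinite C}"
    by (rule inj_on_class_image[OF f A B]) blast
  have "inj_on g {C \<in> A // E. infinite C}" using g(1) by (rule inj_on_subset) auto
  then have "g ` {C \<in> A // E. infinite C} = {C \<in> B // F. infinite C}"
    using fin card g(3) unfolding finitely_many_infinite_classes_def
    by (intro card_seteq) (auto simp: card_image)
  moreover have "f x \<in> B" using f x(1) unfolding is_embedding_def by blast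
  then have "F `` {f x} \<in> {C \<in> B // F. infinite C}" using inf quotientI by auto
  ultimately have "F `` {f x} \<in> g ` {C \<in> A // E. infinite C}" by simp
  then obtain C where "C \<in> A // E" "infinite C" "F `` {f x} = g C" by blast
  then show False using g(2)[OF x(1)] inj_onD[OF g(1)] quotientI[OF x(1)] x(2) by metis
qed

text \<open>The infinite classes of \<open>B\<close> are used up by those of \<open>A\<close>, so
  finite classes of \<open>A\<close> land in finite classes of \<open>B\<close> and inherit the
  bound \<open>k\<close>.\<close>

lemma bounded_character_embeds:
  assumes "embeds A E B F" and A: "equiv A E" and B: "equiv B F"
    and fin: "finitely_many_infinite_classes B F"
    and card: "card {C \<in> B // F. infinite C} \<le> card {C \<in> A // E. infinite C}"
    and bdd: "bounded_character B F"
  shows "bounded_character A E"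
proof -
  obtain f where f: "is_embedding f A E B F" using assms(1) unfolding embeds_def by blast
  obtain k where k: "\<And>C. C \<in> B // F \<Longrightarrow> finite C \<Longrightarrow> card C \<le> k"
    using bdd unfolding bounded_character_def by blast
  have "card C \<le> k" if "C \<in> A // E" "finite C" for C
  proof -
    obtain x where x: "C = E `` {x}" "x \<in> A" using \<open>C \<in> A // E\<close> by (auto elim: quotientE)
    then have "finite (F `` {f x})"
      using is_embedding_finite_class[OF f A B fin card] that(2) by blast
    moreover have "f x \<in> B" using f x(2) unfolding is_embedding_def by blast
    ultimately show ?thesis
      using is_embedding_card_class[OF f A x(2)] k[of "F `` {f x}"] quotientI[of "f x" B F] x(1)
      by auto
  qed
  then show ?thesis unfolding bounded_character_def by blast
qed

lemma computably_embeds_trans: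
  assumes "computably_embeds A E B F" "computably_embeds B F C G"
  shows "computably_embeds A E C G"
proof -
  obtain f g where f: "computable_fun f" "is_embedding f A E B F"
    and g: "computable_fun g" "is_embedding g B F C G"
    using assms unfolding computably_embeds_def by blast
  have "is_embedding (\<lambda>x. g (f x)) A E C G"
    using f(2) g(2) unfolding is_embedding_def inj_on_def image_subset_iff by (safe; metis)
  then show ?thesis
    using computable_fun_compose[OF g(1) f(1)] unfolding computably_embeds_def by blast
qed

section \<open>Diagonal structures\<close>

text \<open>The element \<open>pair c s\<close> is position \<open>s\<close> of column
  \<open>c\<close>, and the classes are the non-empty columns. A structure is thus designed by
  deciding which positions to fill.\<close>

definition column_rel :: "nat set \<Rightarrow> (nat \<times> nat) set" where
  "column_rel B = {(x, y). x \<in> B \<and> y \<in> B \<and> p1 x = p1 y}"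

definition column :: "nat set \<Rightarrow> nat \<Rightarrow> nat set" where
  "column B c = {s. pair c s \<in> B}"

lemma inj_pair: "inj_on (pair c) S"
  by (auto intro: inj_onI)

lemma column_rel_class: "x \<in> B \<Longrightarrow> column_rel B `` {x} = pair (p1 x) ` column B (p1 x)"
proof (intro equalityI subsetI)
  fix y assume "y \<in> column_rel B `` {x}"
  then have "y \<in> B" "p1 x = p1 y" by (auto simp: column_rel_def)
  then show "y \<in> pair (p1 x) ` column B (p1 x)"
    unfolding column_def by (intro image_eqI[of _ _ "p2 y"]) auto
qed (auto simp: column_rel_def column_def)

lemma column_in_quotient:
  assumes "s \<in> column B c"
  shows "pair c ` column B c \<in> B // column_rel B"
proof -
  have s: "pair c s \<in> B" using assms by (simp add: column_def)
  show ?thesis using quotientI[OF s, of "column_rel B"] unfolding column_rel_class[OF s] by simp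
qed

lemma equiv_column_rel: "equiv B (column_rel B)"
  by (auto simp: column_rel_def equiv_def refl_on_def sym_def trans_def)

lemma computable_column_structure:
  assumes "decidable (\<lambda>x. x \<in> B)"
  shows "computable_eq_structure B (column_rel B)"
proof -
  have "decidable (\<lambda>q. (p1 q, p2 q) \<in> column_rel B)"
    unfolding column_rel_def
    by (simp, intro decidable_conj decidable_eq decidable_compose[OF assms] computable_intros)
  then show ?thesis
    using equiv_column_rel computable_setI[OF assms] computable_relI
    unfolding computable_eq_structure_def eq_structure_def by blast
qed

lemma infinite_column_classes:
  "{C \<in> B // column_rel B. infinite C} = (\<lambda>c. pair c ` column B c) ` {c. infinite (column B c)}"
proof (intro equalityI subsetI)
  fix C assume "C \<in> {C \<in> B // column_rel B. infinite C}"
  then obtain x where "x \<in> B" "C = column_rel B `` {x}" "infinite C" by (auto elim: quotientE)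
  then show "C \<in> (\<lambda>c. pair c ` column B c) ` {c. infinite (column B c)}"
    using column_rel_class[of x B] by (intro image_eqI[of _ _ "p1 x"]) auto
next
  fix C assume "C \<in> (\<lambda>c. pair c ` column B c) ` {c. infinite (column B c)}"
  then obtain c where c: "infinite (column B c)" "C = pair c ` column B c" by auto
  then obtain s where "s \<in> column B c" using not_finite_existsD by fastforce
  then have "C \<in> B // column_rel B" unfolding c(2) by (rule column_in_quotient)
  moreover have "infinite C" using c by (simp add: finite_image_iff inj_pair)
  ultimately show "C \<in> {C \<in> B // column_rel B. infinite C}" by simp
qed

lemma inj_on_column_classes: "inj_on (\<lambda>c. pair c ` column B c) {c. infinite (column B c)}"
proof (rule inj_onI)
  fix c d assume c: "c \<in> {c. infinite (column B c)}" and eq: "pair c ` column B c = pair d ` column B d"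
  have "column B c \<noteq> {}" using c by auto
  then obtain s where "pair c s \<in> pair d ` column B d" using eq by blast
  then show "c = d" by auto
qed

lemma finitely_many_infinite_columns:
  "finitely_many_infinite_classes B (column_rel B) \<longleftrightarrow> finite {c. infinite (column B c)}"
  unfolding finitely_many_infinite_classes_def infinite_column_classes
  by (rule finite_image_iff[OF inj_on_column_classes])

lemma card_infinite_columns:
  "card {C \<in> B // column_rel B. infinite C} = card {c. infinite (column B c)}"
  unfolding infinite_column_classes by (rule card_image[OF inj_on_column_classes])

lemma unbounded_columns:
  assumes "\<And>k. \<exists>c. finite (column B c) \<and> k < card (column B c)"
  shows "\<not> bounded_character B (column_rel B)"
proof
  assume "bounded_character B (column_rel B)"
  then obtain k where k: "\<And>C. C \<in> B // column_rel B \<Longrightarrow> finite C \<Longrightarrow> card C \<le> k"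
    unfolding bounded_character_def by blast
  obtain c where c: "finite (column B c)" "k < card (column B c)" using assms by blast
  then have "column B c \<noteq> {}" by auto
  then obtain s where "s \<in> column B c" by blast
  then have "pair c ` column B c \<in> B // column_rel B" by (rule column_in_quotient)
  from k[OF this] c show False by (simp add: card_image inj_pair)
qed

text \<open>Post's simple set: index \<open>e\<close> captures the first value exceeding \<open>2 * e\<close> which the function with
  index \<open>e\<close> is seen to take; the code \<open>w\<close> stands for argument, value and computation.\<close>

definition large_value :: "nat \<Rightarrow> nat \<Rightarrow> bool" where
  "large_value e w \<longleftrightarrow> e + e < p1 (p2 w) \<and> halts e (p1 w) (p1 (p2 w)) (p2 (p2 w))"

text \<open>\<open>s\<close> acts as a stage bounding the search for \<open>w\<close>. The bound
  \<open>e<j\<close> loses nothing, because captured values exceed \<open>2 * e\<close>, and it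
  keeps the predicate decidable.\<close>

definition captured :: "nat \<Rightarrow> nat \<Rightarrow> bool" where
  "captured j s \<longleftrightarrow> (\<exists>e<j. \<exists>w<s. (large_value e w \<and> (\<forall>v<w. \<not> large_value e v)) \<and> j = p1 (p2 w))"

text \<open>A column is filled until its index is seen to be captured, so the infinite columns are
  those indexed by the complement of the simple set.\<close>

definition simple_columns :: "nat set" where
  "simple_columns = {x. \<not> captured (p1 x) (p2 x)}"

lemma decidable_simple_columns: "decidable (\<lambda>x. x \<in> simple_columns)"
  unfolding simple_columns_def captured_def large_value_def mem_Collect_eq
  by (intro computable_intros decidable_halts)

lemma column_simple_columns: "column simple_columns c = {s. \<not> captured c s}"
  by (simp add: column_def simple_columns_def)

text \<open>A captured number \<open>j \<le> 2 * n\<close> comes from an index below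
  \<open>n\<close>, and each index captures at most one number. If only \<open>n\<close> numbers
  escaped, the \<open>2 * n + 1\<close> numbers up to \<open>2 * n\<close> would be covered by
  \<open>n + n\<close>.\<close>

lemma infinite_not_captured: "infinite {j. \<forall>s. \<not> captured j s}" (is "infinite ?N")
proof
  assume fin: "finite ?N"
  define n where "n = card ?N"
  define J where "J e = p1 (p2 (LEAST w. large_value e w))" for e
  have "j \<in> J ` {..<n}" if cap: "captured j s" and j: "j \<le> 2 * n" for j s
  proof -
    obtain e w where w: "large_value e w" "\<And>v. v < w \<Longrightarrow> \<not> large_value e v" "j = p1 (p2 w)"
      using cap unfolding captured_def by blast
    have "(LEAST w. large_value e w) = w"
      by (rule Least_equality) (use w not_le in blast)+
    then have "j = J e" using w(3) by (simp add: J_def)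
    moreover have "e < n" using w(1,3) j by (simp add: large_value_def)
    ultimately show ?thesis by simp
  qed
  then have "{..2 * n} \<subseteq> J ` {..<n} \<union> ?N" by auto
  then have "card {..2 * n} \<le> card (J ` {..<n} \<union> ?N)" using fin by (intro card_mono) auto
  also have "\<dots> \<le> card (J ` {..<n}) + card ?N" by (rule card_Un_le)
  also have "\<dots> \<le> n + n" using card_image_le[of "{..<n}" J] by (simp add: n_def)
  finally show False by simp
qed

lemma simple_columns_infinitely_many:
  "\<not> finitely_many_infinite_classes simple_columns (column_rel simple_columns)"
proof -
  have "{j. \<forall>s. \<not> captured j s} \<subseteq> {c. infinite (column simple_columns c)}"
    by (auto simp: column_simple_columns)
  then show ?thesis
    unfolding finitely_many_infinite_columns using infinite_not_captured finite_subset by blast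
qed

lemma decidable_UNIV: "decidable (\<lambda>x. x \<in> UNIV)"
  by (simp add: decidable_def computable_fun_const)

lemma UNIV_infinitely_many: "\<not> finitely_many_infinite_classes UNIV (column_rel UNIV)"
  unfolding finitely_many_infinite_columns by (simp add: column_def)

text \<open>The map \<open>h\<close> from source columns to target columns is computable and
  injective, hence unbounded, so its own index captures one of its values. That column is finite
  although an infinite column is sent into it.\<close>

lemma UNIV_not_computably_embeds_simple_columns:
  "\<not> computably_embeds UNIV (column_rel UNIV) simple_columns (column_rel simple_columns)"
proof
  assume "computably_embeds UNIV (column_rel UNIV) simple_columns (column_rel simple_columns)"
  then obtain f where f: "computable_fun f"
    "is_embedding f UNIV (column_rel UNIV) simple_columns (column_rel simple_columns)"
    unfolding computably_embeds_def by blast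
  define h where "h i = p1 (f (pair i 0))" for i
  have fS: "f x \<in> simple_columns" for x using f(2) unfolding is_embedding_def by blast
  have inj: "inj h"
  proof (rule injI)
    fix i j assume "h i = h j"
    then have "(f (pair i 0), f (pair j 0)) \<in> column_rel simple_columns"
      using fS by (simp add: h_def column_rel_def)
    then have "(pair i 0, pair j 0) \<in> column_rel UNIV"
      using f(2) unfolding is_embedding_def by blast
    then show "i = j" by (simp add: column_rel_def)
  qed
  have "computable_fun h"
    unfolding h_def[abs_def] by (intro computable_intros computable_fun_compose[OF f(1)])
  then obtain e where e: "\<And>x. \<exists>d. halts e x (h x) d" "\<And>x y d. halts e x y d \<Longrightarrow> y = h x"
    by (rule index_exists) blast
  have "infinite (range h)" using inj by (simp add: finite_image_iff)
  then obtain i where i: "e + e < h i" unfolding infinite_nat_iff_unbounded by blast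
  obtain d where "halts e i (h i) d" using e(1) by blast
  then have ex: "\<exists>w. large_value e w"
    using i by (intro exI[of _ "pair i (pair (h i) d)"]) (simp add: large_value_def)
  define w where "w = (LEAST w. large_value e w)"
  have w: "large_value e w" "\<And>v. v < w \<Longrightarrow> \<not> large_value e v"
    unfolding w_def using LeastI_ex[OF ex] not_less_Least by blast+
  then have j: "p1 (p2 w) = h (p1 w)" "e < p1 (p2 w)" using e(2) by (auto simp: large_value_def)
  \<comment> \<open>After stage \<open>w\<close> nothing more enters this column.\<close>
  have "captured (h (p1 w)) s" if "w < s" for s
    using w j that unfolding captured_def by metis
  then have "column simple_columns (h (p1 w)) \<subseteq> {..w}"
    unfolding column_simple_columns by (auto simp: not_less[symmetric])
  then have "finite (column simple_columns (h (p1 w)))" by (rule finite_subset) simp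
  then have "finite (column_rel simple_columns `` {f (pair (p1 w) 0)})"
    using column_rel_class[OF fS] by (simp add: h_def)
  then have "finite (column_rel UNIV `` {pair (p1 w) 0})"
    using is_embedding_card_class[OF f(2) equiv_column_rel, of "pair (p1 w) 0"] by simp
  then show False
    by (simp add: column_rel_class finite_image_iff inj_pair column_def)
qed

section \<open>Columns defeating every computable bound on the sizes of finite classes\<close>

definition standard_columns :: "nat \<Rightarrow> nat set" where
  "standard_columns m = {x. p1 x < m \<or> p2 x \<le> p1 x}"

text \<open>The first \<open>m\<close> columns are kept infinite, so column \<open>c\<close> deals
  with index \<open>c - m\<close>. Here \<open>w\<close> codes a value with its certificate; taking
  the least one makes it unique, which keeps the column finite.\<close>

definition first_value :: "nat \<Rightarrow> nat \<Rightarrow> nat \<Rightarrow> bool" where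
  "first_value m c w \<longleftrightarrow> halts (c - m) (pair c 0) (p1 w) (p2 w) \<and>
     (\<forall>v<w. \<not> halts (c - m) (pair c 0) (p1 v) (p2 v))"

text \<open>If the function with index \<open>e\<close> is seen to send the bottom of column \<open>c = m + e\<close> into column \<open>p1 y\<close> of
  the standard structure, which has \<open>p1 y + 1\<close> elements, then column \<open>c\<close> receives \<open>p1 y + 2\<close>
  elements.\<close>

definition growing_columns :: "nat \<Rightarrow> nat set" where
  "growing_columns m = {x. p1 x < m \<or> p2 x \<le> p1 x \<or>
     (\<exists>w<Suc (p2 x). first_value m (p1 x) w \<and> p2 x \<le> Suc (w + p1 (p1 w)))}"

lemma decidable_standard_columns: "decidable (\<lambda>x. x \<in> standard_columns m)"
  unfolding standard_columns_def mem_Collect_eq by (intro computable_intros)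

lemma decidable_growing_columns: "decidable (\<lambda>x. x \<in> growing_columns m)"
  unfolding growing_columns_def first_value_def mem_Collect_eq
  by (intro computable_intros decidable_halts)

lemma column_standard_columns: "column (standard_columns m) c = (if c < m then UNIV else {..c})"
  by (auto simp: standard_columns_def column_def)

lemma column_growing_columns:
  "column (growing_columns m) c = (if c < m then UNIV else
     {s. s \<le> c \<or> (\<exists>w\<le>s. first_value m c w \<and> s \<le> Suc (w + p1 (p1 w)))})"
  by (auto simp: growing_columns_def column_def less_Suc_eq_le)

lemma finite_column_growing_columns:
  assumes "m \<le> c"
  shows "finite (column (growing_columns m) c)"
proof -
  have uniq: "v = w" if "first_value m c v" "first_value m c w" for v w
    using that unfolding first_value_def by (metis nat_neq_iff)
  have "finite {s. \<exists>w\<le>s. first_value m c w \<and> s \<le> Suc (w + p1 (p1 w))}"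
  proof (cases "\<exists>w. first_value m c w")
    case True
    then obtain w where "first_value m c w" by blast
    then have "{s. \<exists>w\<le>s. first_value m c w \<and> s \<le> Suc (w + p1 (p1 w))} \<subseteq> {..Suc (w + p1 (p1 w))}"
      using uniq by blast
    then show ?thesis by (rule finite_subset) simp
  qed simp
  then have "finite ({..c} \<union> {s. \<exists>w\<le>s. first_value m c w \<and> s \<le> Suc (w + p1 (p1 w))})" by simp
  then show ?thesis
    by (rule rev_finite_subset) (use assms in \<open>auto simp: column_growing_columns\<close>)
qed

lemma standard_columns_infinite: "{c. infinite (column (standard_columns m) c)} = {..<m}"
  by (auto simp: column_standard_columns)

lemma growing_columns_infinite: "{c. infinite (column (growing_columns m) c)} = {..<m}"
  using finite_column_growing_columns[of m] by (auto simp: column_growing_columns not_le[symmetric])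

lemma standard_columns_unbounded:
  "\<not> bounded_character (standard_columns m) (column_rel (standard_columns m))"
proof (rule unbounded_columns)
  fix k
  show "\<exists>c. finite (column (standard_columns m) c) \<and> k < card (column (standard_columns m) c)"
    by (rule exI[of _ "k + m"]) (simp add: column_standard_columns)
qed

lemma growing_columns_unbounded:
  "\<not> bounded_character (growing_columns m) (column_rel (growing_columns m))"
proof (rule unbounded_columns)
  fix k
  have fin: "finite (column (growing_columns m) (k + m))" by (rule finite_column_growing_columns) simp
  have "{..k + m} \<subseteq> column (growing_columns m) (k + m)" by (auto simp: column_growing_columns)
  then have "card {..k + m} \<le> card (column (growing_columns m) (k + m))" by (rule card_mono[OF fin])
  with fin show "\<exists>c. finite (column (growing_columns m) c) \<and> k < card (column (growing_columns m) c)"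
    by (intro exI[of _ "k + m"]) simp
qed

text \<open>Column \<open>c\<close> belonging to the index of \<open>f\<close> waits until the value
  of \<open>f\<close> at its bottom is known, and then outgrows the target column by one
  element.\<close>

lemma growing_not_computably_embeds_standard:
  "\<not> computably_embeds (growing_columns m) (column_rel (growing_columns m))
      (standard_columns m) (column_rel (standard_columns m))"
proof
  assume "computably_embeds (growing_columns m) (column_rel (growing_columns m))
      (standard_columns m) (column_rel (standard_columns m))"
  then obtain f where f: "computable_fun f"
    "is_embedding f (growing_columns m) (column_rel (growing_columns m))
      (standard_columns m) (column_rel (standard_columns m))"
    unfolding computably_embeds_def by blast
  obtain e where e: "\<And>x. \<exists>d. halts e x (f x) d" "\<And>x y d. halts e x y d \<Longrightarrow> y = f x"
    using f(1) by (rule index_exists) blast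
  define c where "c = e + m"
  define x where "x = pair c 0"
  have x: "x \<in> growing_columns m" by (simp add: x_def growing_columns_def)
  then have fx: "f x \<in> standard_columns m" using f(2) unfolding is_embedding_def by blast
  have fin_c: "finite (column (growing_columns m) c)"
    by (rule finite_column_growing_columns) (simp add: c_def)
  have class_x: "column_rel (growing_columns m) `` {x} = pair c ` column (growing_columns m) c"
    using column_rel_class[OF x] by (simp add: x_def)
  have class_fx: "column_rel (standard_columns m) `` {f x} =
      pair (p1 (f x)) ` column (standard_columns m) (p1 (f x))"
    by (rule column_rel_class[OF fx])
  \<comment> \<open>Both structures have exactly \<open>m\<close> infinite classes, so a finite
    column cannot be sent into an infinite one.\<close>
  have "finite (column_rel (standard_columns m) `` {f x})"
  proof (rule is_embedding_finite_class[OF f(2) equiv_column_rel equiv_column_rel _ _ x])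
    show "finite (column_rel (growing_columns m) `` {x})" using class_x fin_c by simp
  qed (simp_all add: finitely_many_infinite_columns card_infinite_columns
      standard_columns_infinite growing_columns_infinite)
  then have "\<not> p1 (f x) < m"
    unfolding class_fx by (simp add: finite_image_iff inj_pair column_standard_columns split: if_splits)
  moreover have "card (column (growing_columns m) c) \<le> card (column (standard_columns m) (p1 (f x)))"
    using is_embedding_card_class[OF f(2) equiv_column_rel x] \<open>finite (column_rel _ `` {f x})\<close>
    unfolding class_x class_fx by (simp add: card_image inj_pair)
  ultimately have le: "card (column (growing_columns m) c) \<le> Suc (p1 (f x))"
    by (simp add: column_standard_columns)
  obtain d where "halts e x (f x) d" using e(1) by blast
  then have ex: "\<exists>w. halts e x (p1 w) (p2 w)" by (intro exI[of _ "pair (f x) d"]) simp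
  define w where "w = (LEAST w. halts e x (p1 w) (p2 w))"
  have w: "halts e x (p1 w) (p2 w)" "\<And>v. v < w \<Longrightarrow> \<not> halts e x (p1 v) (p2 v)"
    unfolding w_def using LeastI_ex[OF ex] not_less_Least by blast+
  have "first_value m c w" unfolding first_value_def using w by (simp add: c_def x_def)
  moreover have "p1 w = f x" using e(2) w(1) by blast
  \<comment> \<open>The added positions start at \<open>w\<close>, so that at position
    \<open>s\<close> only \<open>w \<le> s\<close> need be searched; there are
    \<open>p1 (f x) + 2\<close> of them, one more than the target column holds.\<close>
  ultimately have "{w..Suc (w + p1 (f x))} \<subseteq> column (growing_columns m) c"
    unfolding column_growing_columns by auto
  then have "card {w..Suc (w + p1 (f x))} \<le> card (column (growing_columns m) c)"
    by (rule card_mono[OF fin_c])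
  with le show False by simp
qed

text \<open>The embedding is composed through \<open>A\<close>. The diagonalisation can therefore be
  done between two convenient copies, whatever \<open>A\<close> itself looks like.\<close>

lemma categorical_imp_computably_embeds:
  assumes cat: "comp_bi_emb_categorical A E"
    and "computable_eq_structure B F" "computable_eq_structure C G"
    and "embeds A E B F" "embeds B F A E" "embeds A E C G" "embeds C G A E"
  shows "computably_embeds B F C G"
  using assms computably_embeds_trans
  unfolding comp_bi_emb_categorical_def bi_embeddable_def computably_bi_embeddable_def by meson

section \<open>The two directions of the equivalence\<close>

lemma bounded_imp_categorical:
  assumes comp: "computable_eq_structure A E"
    and fin: "finitely_many_infinite_classes A E" and bdd: "bounded_character A E"
  shows "comp_bi_emb_categorical A E"
  unfolding comp_bi_emb_categorical_def bi_embeddable_def computably_bi_embeddable_def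
proof (intro allI impI)
  have A: "equiv A E" using comp unfolding computable_eq_structure_def eq_structure_def by blast
  fix B F assume *: "computable_eq_structure B F \<and> embeds A E B F \<and> embeds B F A E"
  then have B: "equiv B F" unfolding computable_eq_structure_def eq_structure_def by blast
  \<comment> \<open>Both conditions are transferred to \<open>B\<close>, because the embedding of
    \<open>B\<close> into \<open>A\<close> is made computable by the same lemma.\<close>
  have finB: "finitely_many_infinite_classes B F"
    using embeds_infinite_classes(1)[OF _ B A fin] * by blast
  have card: "card {C \<in> A // E. infinite C} \<le> card {C \<in> B // F. infinite C}"
    using embeds_infinite_classes(2)[OF _ A B finB] * by blast
  have "bounded_character B F"
    using bounded_character_embeds[OF _ B A fin card bdd] * by blast
  then show "computably_embeds A E B F \<and> computably_embeds B F A E"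
    using computably_embedsI comp * fin bdd finB by blast
qed

lemma categorical_imp_finitely_many:
  assumes A: "equiv A E" and cat: "comp_bi_emb_categorical A E"
  shows "finitely_many_infinite_classes A E"
proof (rule ccontr)
  assume inf: "\<not> finitely_many_infinite_classes A E"
  have "computably_embeds UNIV (column_rel UNIV) simple_columns (column_rel simple_columns)"
    by (rule categorical_imp_computably_embeds[OF cat];
        intro computable_column_structure decidable_UNIV decidable_simple_columns
          embeds_infinitely_many A equiv_column_rel inf UNIV_infinitely_many
          simple_columns_infinitely_many)
  then show False using UNIV_not_computably_embeds_simple_columns by blast
qed

lemma categorical_imp_bounded:
  assumes A: "equiv A E" and cat: "comp_bi_emb_categorical A E"
  shows "bounded_character A E"
proof (rule ccontr)
  assume unb: "\<not> bounded_character A E"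
  \<comment> \<open>With this number of infinite columns both column structures are bi-embeddable
    with \<open>A\<close>; it is a true count because \<open>A\<close> is already known to have
    finitely many infinite classes.\<close>
  define m where "m = card {C \<in> A // E. infinite C}"
  let ?S = "standard_columns m" and ?G = "growing_columns m"
  have "computably_embeds ?G (column_rel ?G) ?S (column_rel ?S)"
  proof (rule categorical_imp_computably_embeds[OF cat])
    show "computable_eq_structure ?G (column_rel ?G)" "computable_eq_structure ?S (column_rel ?S)"
      by (intro computable_column_structure decidable_growing_columns decidable_standard_columns)+
    have IG: "finite {C \<in> ?G // column_rel ?G. infinite C}"
        "card {C \<in> ?G // column_rel ?G. infinite C} = m"
      and IS: "finite {C \<in> ?S // column_rel ?S. infinite C}"
        "card {C \<in> ?S // column_rel ?S. infinite C} = m"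
      unfolding card_infinite_columns finitely_many_infinite_classes_def[symmetric]
        finitely_many_infinite_columns standard_columns_infinite growing_columns_infinite by simp_all
    have IA: "finite {C \<in> A // E. infinite C}"
      using categorical_imp_finitely_many[OF A cat] unfolding finitely_many_infinite_classes_def .
    show "embeds A E ?G (column_rel ?G)"
      by (rule embeds_unbounded[OF A equiv_column_rel IA _ growing_columns_unbounded])
        (simp only: IG(2) m_def[symmetric] order_refl)
    show "embeds A E ?S (column_rel ?S)"
      by (rule embeds_unbounded[OF A equiv_column_rel IA _ standard_columns_unbounded])
        (simp only: IS(2) m_def[symmetric] order_refl)
    show "embeds ?G (column_rel ?G) A E"
      by (rule embeds_unbounded[OF equiv_column_rel A IG(1) _ unb])
        (simp only: IG(2) m_def[symmetric] order_refl)
    show "embeds ?S (column_rel ?S) A E"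
      by (rule embeds_unbounded[OF equiv_column_rel A IS(1) _ unb])
        (simp only: IS(2) m_def[symmetric] order_refl)
  qed
  then show False using growing_not_computably_embeds_standard by blast
qed

theorem theorem2p6:
  fixes A :: "nat set" and E :: "(nat \<times> nat) set"
  assumes "computable_eq_structure A E"
  shows "comp_bi_emb_categorical A E \<longleftrightarrow>
           (finitely_many_infinite_classes A E \<and> bounded_character A E)"
proof -
  have "equiv A E" using assms unfolding computable_eq_structure_def eq_structure_def by blast
  then show ?thesis
    using bounded_imp_categorical[OF assms] categorical_imp_finitely_many categorical_imp_bounded
    by blast
qed

end
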